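(* Let $0<\alpha<1$ and let $T$ be a $(C,\alpha)$-bounded operator on a complex Banach space $X$ with $\overline{\operatorname{Ran}}(I-T)=X$. For a given $x\in X$ the following are equivalent: (i) $x\in\operatorname{Dom}(\log(I-T))$. (ii) The series $\sum_{n=1}^\infty\frac1nT^nx$ converges (in norm or, equivalently, weakly). If (i) or (ii) holds, then $$\log(I-T)x=-\sum_{n=1}^\infty\frac1nT^nx.$$
   Context: For $\alpha\in\mathbb R$: $k^\alpha(0)=1$, $k^\alpha(n)=\frac{\alpha(\alpha+1)\cdots(\alpha+n-1)}{n!}$ for $n\ge1$. For $T\in\mathcal B(X)$: $\Delta^{-\alpha}\mathcal T(n)=\sum_{j=0}^nk^\alpha(n-j)T^j$, and $T$ is $(C,\alpha)$-bounded if $\sup_n\|\Delta^{-\alpha}\mathcal T(n)\|/k^{\alpha+1}(n)<\infty$. Put $D^\alpha f(n)=\sum_{j=n}^\infty k^{-\alpha}(j-n)f(j)$ and $W^{-\alpha}f(n)=\sum_{j=n}^\infty k^{\alpha}(j-n)f(j)$. $A^\alpha(\mathbb D)$ is the Banach algebra of functions $\mathfrak h(z)=\sum h(n)z^n$ with $h\in\ell^1$, $h=W^{-\alpha}u$ for some (unique, equal to $D^\alpha h$) sequence $u$ with $\sum_n|u(n)|k^{\alpha+1}(n)<\infty$. For $T$ $(C,\alpha)$-bounded and $\mathfrak h\in A^\alpha(\mathbb D)$, $\mathfrak h(T):=\sum_{n\ge0}D^\alpha h(n)\Delta^{-\alpha}\mathcal T(n)\in\mathcal B(X)$, a bounded algebra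 homomorphism. Under the hypotheses $I-T$ is injective, $(1-z)\log(1-z)\in A^\alpha(\mathbb D)$, and $\log(I-T)$ is the closed operator $\log(I-T):=(I-T)^{-1}\,[(1-z)\log(1-z)](T)$, with domain $\{x\in X:[(1-z)\log(1-z)](T)x\in\operatorname{Ran}(I-T)\}$. (It is also the infinitesimal generator of the holomorphic $C_0$-semigroup $((I-T)^s)_{\mathrm{Re}\,s>0}$ given by the functional calculus.) *)

theory Defs
  imports "HOL-Complex_Analysis.Complex_Analysis"
begin

text \<open>The library has real Banach spaces only. A complex Banach space is a real one with
  a compatible complex scalar multiplication; for complex-linear operators, the operator norm
  of \<open>\<Rightarrow>\<^sub>L\<close> is the usual one.\<close>

class complex_banach = banach +
  fixes scaleC :: "complex \<Rightarrow> 'a \<Rightarrow> 'a"  (infixr \<open>*\<^sub>C\<close> 75)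
  assumes scaleC_add_right: "c *\<^sub>C (x + y) = c *\<^sub>C x + c *\<^sub>C y"
    and scaleC_add_left: "(c + d) *\<^sub>C x = c *\<^sub>C x + d *\<^sub>C x"
    and scaleC_scaleC: "c *\<^sub>C d *\<^sub>C x = (c * d) *\<^sub>C x"
    and scaleC_of_real: "complex_of_real r *\<^sub>C x = r *\<^sub>R x"
    and norm_scaleC: "norm (c *\<^sub>C x) = cmod c * norm x"

instantiation complex :: complex_banach
begin

definition scaleC_complex :: "complex \<Rightarrow> complex \<Rightarrow> complex" where
  "scaleC_complex c x = c * x"

instance
  by standard (simp_all add: scaleC_complex_def algebra_simps norm_mult scaleR_conv_of_real)

end

lemma bounded_linear_scaleC: "bounded_linear (\<lambda>x::'a::complex_banach. c *\<^sub>C x)"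
proof (rule bounded_linear_intro[where K = "cmod c"])
  show "c *\<^sub>C r *\<^sub>R x = r *\<^sub>R c *\<^sub>C x" for r and x :: 'a
    by (simp flip: scaleC_of_real add: scaleC_scaleC mult.commute)
qed (simp_all add: scaleC_add_right norm_scaleC mult.commute)

instantiation blinfun :: (real_normed_vector, complex_banach) complex_banach
begin

lift_definition scaleC_blinfun :: "complex \<Rightarrow> 'a \<Rightarrow>\<^sub>L 'b \<Rightarrow> 'a \<Rightarrow>\<^sub>L 'b" is
  "\<lambda>c A x. c *\<^sub>C A x"
  by (rule bounded_linear_compose[OF bounded_linear_scaleC])

instance
proof
  fix c d :: complex and r :: real and A B :: "'a \<Rightarrow>\<^sub>L 'b"
  show "c *\<^sub>C (A + B) = c *\<^sub>C A + c *\<^sub>C B"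
    by transfer (simp add: scaleC_add_right)
  show "(c + d) *\<^sub>C A = c *\<^sub>C A + d *\<^sub>C A"
    by transfer (simp add: scaleC_add_left)
  show "c *\<^sub>C d *\<^sub>C A = (c * d) *\<^sub>C A"
    by transfer (simp add: scaleC_scaleC)
  show "complex_of_real r *\<^sub>C A = r *\<^sub>R A"
    by transfer (simp add: scaleC_of_real)
  have "onorm (\<lambda>x. c *\<^sub>C blinfun_apply A x) = cmod c * onorm (blinfun_apply A)"
    using onorm_scaleR[OF blinfun.bounded_linear_right[of A], of "cmod c"]
    by (simp add: onorm_def norm_scaleC)
  then show "norm (c *\<^sub>C A) = cmod c * norm A"
    by (simp add: norm_blinfun.rep_eq scaleC_blinfun.rep_eq)
qed

end

definition bounded_clinear :: "('a::complex_banach \<Rightarrow> 'b::complex_banach) \<Rightarrow> bool" where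
  "bounded_clinear f \<longleftrightarrow> bounded_linear f \<and> (\<forall>c x. f (c *\<^sub>C x) = c *\<^sub>C f x)"

definition weakly_sums :: "(nat \<Rightarrow> 'a::complex_banach) \<Rightarrow> 'a \<Rightarrow> bool" where
  "weakly_sums f s \<longleftrightarrow>
     (\<forall>\<phi> :: 'a \<Rightarrow> complex. bounded_clinear \<phi> \<longrightarrow> (\<lambda>n. \<phi> (f n)) sums \<phi> s)"

definition weakly_summable :: "(nat \<Rightarrow> 'a::complex_banach) \<Rightarrow> bool" where
  "weakly_summable f \<longleftrightarrow> (\<exists>s. weakly_sums f s)"

primrec blinfun_pow :: "'a::real_normed_vector \<Rightarrow>\<^sub>L 'a \<Rightarrow> nat \<Rightarrow> 'a \<Rightarrow>\<^sub>L 'a" where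
  "blinfun_pow T 0 = id_blinfun"
| "blinfun_pow T (Suc n) = T o\<^sub>L blinfun_pow T n"

definition cesaro_kernel :: "real \<Rightarrow> nat \<Rightarrow> real" where
  "cesaro_kernel \<alpha> n = pochhammer \<alpha> n / fact n"

definition cesaro_sum :: "real \<Rightarrow> 'a::real_normed_vector \<Rightarrow>\<^sub>L 'a \<Rightarrow> nat \<Rightarrow> 'a \<Rightarrow>\<^sub>L 'a" where
  "cesaro_sum \<alpha> T n = (\<Sum>j\<le>n. cesaro_kernel \<alpha> (n - j) *\<^sub>R blinfun_pow T j)"

definition cesaro_bounded :: "real \<Rightarrow> 'a::real_normed_vector \<Rightarrow>\<^sub>L 'a \<Rightarrow> bool" where
  "cesaro_bounded \<alpha> T \<longleftrightarrow>
     bdd_above (range (\<lambda>n. norm (cesaro_sum \<alpha> T n) / cesaro_kernel (\<alpha> + 1) n))"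

text \<open>In the next two definitions the summation index is \<open>j - n\<close>.\<close>

definition weyl_diff :: "real \<Rightarrow> (nat \<Rightarrow> complex) \<Rightarrow> nat \<Rightarrow> complex" where
  "weyl_diff \<alpha> f n = (\<Sum>i. of_real (cesaro_kernel (- \<alpha>) i) * f (n + i))"

definition weyl_sum :: "real \<Rightarrow> (nat \<Rightarrow> complex) \<Rightarrow> nat \<Rightarrow> complex" where
  "weyl_sum \<alpha> f n = (\<Sum>i. of_real (cesaro_kernel \<alpha> i) * f (n + i))"

definition taylor_coeff :: "(complex \<Rightarrow> complex) \<Rightarrow> nat \<Rightarrow> complex" where
  "taylor_coeff f n = fps_nth (fps_expansion f 0) n"

definition weighted_disc_algebra :: "real \<Rightarrow> (complex \<Rightarrow> complex) set" where
  "weighted_disc_algebra \<alpha> = {f.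
     (\<forall>z\<in>ball 0 1. (\<lambda>n. taylor_coeff f n * z ^ n) sums f z) \<and>
     summable (\<lambda>n. norm (taylor_coeff f n)) \<and>
     (\<exists>u. summable (\<lambda>n. norm (u n) * cesaro_kernel (\<alpha> + 1) n) \<and>
          taylor_coeff f = weyl_sum \<alpha> u)}"

definition fun_calc ::
    "real \<Rightarrow> 'a::complex_banach \<Rightarrow>\<^sub>L 'a \<Rightarrow> (complex \<Rightarrow> complex) \<Rightarrow> 'a \<Rightarrow>\<^sub>L 'a" where
  "fun_calc \<alpha> T f =
     (if f \<in> weighted_disc_algebra \<alpha>
      then \<Sum>n. weyl_diff \<alpha> (taylor_coeff f) n *\<^sub>C cesaro_sum \<alpha> T n
      else 0)"

text \<open>The unbounded operator \<open>log (I - T)\<close>, given by its domain and its values there.\<close>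

definition dom_log_one_minus :: "real \<Rightarrow> 'a::complex_banach \<Rightarrow>\<^sub>L 'a \<Rightarrow> 'a set" where
  "dom_log_one_minus \<alpha> T =
     {x. fun_calc \<alpha> T (\<lambda>z. (1 - z) * Ln (1 - z)) x \<in> range (id_blinfun - T)}"

definition log_one_minus :: "real \<Rightarrow> 'a::complex_banach \<Rightarrow>\<^sub>L 'a \<Rightarrow> 'a \<Rightarrow> 'a" where
  "log_one_minus \<alpha> T x =
     the_inv (id_blinfun - T) (fun_calc \<alpha> T (\<lambda>z. (1 - z) * Ln (1 - z)) x)"

text \<open>The function defining \<open>log (I - T)\<close> belongs to the algebra for every \<open>\<alpha> > 0\<close>, so
  the default value in \<open>fun_calc\<close> plays no role in \<open>log_one_minus\<close>.\<close>

lemma kernel_sums: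
  fixes t :: real assumes "\<bar>t\<bar> < 1"
  shows "(\<lambda>i. cesaro_kernel \<alpha> i * t ^ i) sums (1 - t) powr - \<alpha>"
proof -
  have "(\<lambda>n. ((-\<alpha>) gchoose n) * (-t)^n) sums (1 + (-t)) powr (-\<alpha>)"
    by (rule gen_binomial_real) (use assms in simp)
  moreover have "((-\<alpha>) gchoose n) * (-t)^n = cesaro_kernel \<alpha> n * t ^ n" for n
    by (simp add: gbinomial_pochhammer cesaro_kernel_def power_minus[of t])
  ultimately show ?thesis by simp
qed

lemma kernel_nonneg: "\<alpha> > 0 \<Longrightarrow> cesaro_kernel \<alpha> n \<ge> 0"
  by (simp add: cesaro_kernel_def pochhammer_nonneg)

lemma integral_power:
  fixes b :: real assumes "b > 0"
  shows "((\<lambda>t. t ^ m * (1 - t) powr (b - 1)) has_integral Beta (real m + 1) b) {0..1}"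
proof (rule has_integral_spike[where S = "{0}" and f = "\<lambda>t. t powr (real m + 1 - 1) * (1 - t) powr (b - 1)"])
  show "((\<lambda>t. t powr (real m + 1 - 1) * (1 - t) powr (b - 1)) has_integral Beta (real m + 1) b) {0..1}"
    by (rule has_integral_Beta_real) (use assms in auto)
qed (auto simp: powr_realpow)

lemma kernel_Beta_sums:
  assumes "\<alpha> > 0"
  shows "(\<lambda>i. cesaro_kernel \<alpha> i * Beta (real (m + i) + 1) (\<alpha> + 2)) sums Beta (real m + 1) 2"
proof -
  define f where "f = (\<lambda>N t. \<Sum>i<N. cesaro_kernel \<alpha> i * (t ^ (m + i) * (1 - t) powr (\<alpha> + 2 - 1)))"
  define g where "g = (\<lambda>t::real. t ^ m * (1 - t) powr (2 - 1))"
  have f: "(f N has_integral (\<Sum>i<N. cesaro_kernel \<alpha> i * Beta (real (m + i) + 1) (\<alpha> + 2))) {0..1}" for N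
    unfolding f_def
    by (intro has_integral_sum has_integral_mult_right integral_power) (use assms in auto)
  have g: "(g has_integral Beta (real m + 1) 2) {0..1}"
    unfolding g_def by (intro integral_power) auto
  have lim: "(\<lambda>i. cesaro_kernel \<alpha> i * (t ^ (m + i) * (1 - t) powr (\<alpha> + 2 - 1))) sums g t"
    if "t \<in> {0..1}" for t
  proof (cases "t = 1")
    case True
    then show ?thesis by (simp add: g_def)
  next
    case False
    then have t: "0 \<le> t" "t < 1" using that by auto
    have "(\<lambda>i. t ^ m * (1 - t) powr (\<alpha> + 1) * (cesaro_kernel \<alpha> i * t ^ i)) sums
        (t ^ m * (1 - t) powr (\<alpha> + 1) * (1 - t) powr - \<alpha>)"
      by (intro sums_mult kernel_sums) (use t in auto)
    also have "t ^ m * (1 - t) powr (\<alpha> + 1) * (1 - t) powr - \<alpha> = g t"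
      using t by (simp add: g_def mult.assoc flip: powr_add)
    finally show ?thesis by (simp add: mult_ac power_add add_ac)
  qed
  have "(\<lambda>N. integral {0..1} (f N)) \<longlonglongrightarrow> integral {0..1} g"
  proof (rule dominated_convergence(2)[where h = g])
    show "f N integrable_on {0..1}" for N using f by blast
    show "g integrable_on {0..1}" using g by blast
    show "norm (f N t) \<le> g t" if "t \<in> {0..1}" for N t
    proof -
      have n: "cesaro_kernel \<alpha> i * (t ^ (m + i) * (1 - t) powr (\<alpha> + 2 - 1)) \<ge> 0" for i
        using that assms by (simp add: kernel_nonneg)
      then have "f N t \<ge> 0" unfolding f_def by (intro sum_nonneg) auto
      moreover have "f N t \<le> g t"
        using sum_le_suminf[OF sums_summable[OF lim[OF that]], of "{..<N}"] n
          sums_unique[OF lim[OF that]] by (simp add: f_def)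
      ultimately show ?thesis by simp
    qed
    show "(\<lambda>N. f N t) \<longlonglongrightarrow> g t" if "t \<in> {0..1}" for t
      using lim[OF that] by (simp add: sums_def f_def)
  qed
  then show ?thesis
    using integral_unique[OF f] integral_unique[OF g] by (simp add: sums_def)
qed

lemma kernel_Beta_prod:
  assumes "\<alpha> > 0"
  shows "Beta (real m + 1) (\<alpha> + 2) * cesaro_kernel (\<alpha> + 1) (m + 2) = (\<alpha> + 1) / ((real m + 1) * (real m + 2))"
proof -
  have nz: "Gamma (\<alpha> + 1) \<noteq> 0" "Gamma (\<alpha> + 1 + real (m + 2)) \<noteq> 0"
    using assms by (auto simp: Gamma_eq_zero_iff elim!: nonpos_Ints_cases')
  have p: "pochhammer (\<alpha> + 1) (m + 2) = Gamma (\<alpha> + 1 + real (m + 2)) / Gamma (\<alpha> + 1)"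
    by (rule pochhammer_Gamma) (use assms in \<open>auto elim!: nonpos_Ints_cases'\<close>)
  have G: "Gamma (\<alpha> + 2) = (\<alpha> + 1) * Gamma (\<alpha> + 1)"
    using Gamma_plus1[of "\<alpha> + 1"] assms by (force elim!: nonpos_Ints_cases' simp: add_ac)
  have F: "Gamma (real m + 1) = fact m" using Gamma_fact[of m, where 'a=real] by (simp add: add.commute)
  have e: "real m + 1 + (\<alpha> + 2) = \<alpha> + 1 + real (m + 2)" by simp
  have "Beta (real m + 1) (\<alpha> + 2) * cesaro_kernel (\<alpha> + 1) (m + 2) =
     fact m * (\<alpha> + 1) / fact (m + 2)"
    unfolding cesaro_kernel_def Beta_def p G F e using nz by (simp del: fact_Suc add: divide_simps)
  also have "\<dots> = (\<alpha> + 1) / ((real m + 1) * (real m + 2))"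
  proof -
    have "fact (m + 2) = (real m + 2) * ((real m + 1) * fact m)" by (simp add: algebra_simps)
    then show ?thesis by (simp only:) simp
  qed
  finally show ?thesis .
qed

lemma Beta_2: "Beta (real m + 1) 2 = 1 / ((real m + 1) * (real m + 2))"
proof -
  have "Beta (real m + 1) 2 = Beta 2 (real m + 1)" by (rule Beta_commute)
  have F: "Gamma (real m + 1) = fact m" using Gamma_fact[of m, where 'a=real] by (simp add: add.commute)
  have F3: "Gamma (real m + 1 + 2) = fact (m + 2)" using Gamma_fact[of "m+2", where 'a=real] by (simp add: add_ac)
  have F2: "Gamma (2::real) = 1" using Gamma_fact[of 1, where 'a=real] by simp
  have "fact (m + 2) = (real m + 2) * ((real m + 1) * fact m)" by (simp add: algebra_simps)
  then show ?thesis unfolding Beta_def F F2 F3 by (simp only:) simp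
qed

lemma taylor_coeff_log:
  fixes f defines "f \<equiv> \<lambda>z. (1 - z) * Ln (1 - z)"
  shows "taylor_coeff f n = (if n = 0 then 0 else if n = 1 then -1 else of_real (1 / (real (n-1) * real n)))"
    and "norm z < 1 \<Longrightarrow> (\<lambda>n. taylor_coeff f n * z ^ n) sums f z"
proof -
  define h :: "nat \<Rightarrow> complex" where
    "h = (\<lambda>n. if n = 0 then 0 else if n = 1 then -1 else of_real (1 / (real (n-1) * real n)))"
  have s: "(\<lambda>n. h n * z ^ n) sums f z" if z: "norm z < 1" for z
  proof -
    have L: "(\<lambda>n. - (z ^ n / of_nat n)) sums Ln (1 - z)"
      using Ln_series'[of "- z"] z by simp
    then have "(\<lambda>n. z * - (z ^ n / of_nat n)) sums (z * Ln (1 - z))" by (rule sums_mult)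
    then have "(\<lambda>n. if n = 0 then 0 else z * - (z ^ (n - 1) / of_nat (n - 1))) sums (z * Ln (1 - z))"
      by (subst sums_Suc_iff[symmetric, where f = "\<lambda>n. if n = 0 then 0 else _ n", simplified]) simp
    from sums_diff[OF L this]
    have "(\<lambda>n. - (z ^ n / of_nat n) - (if n = 0 then 0 else z * - (z ^ (n - 1) / of_nat (n - 1)))) sums f z"
      by (simp add: f_def algebra_simps)
    moreover have "- (z ^ n / of_nat n) - (if n = 0 then 0 else z * - (z ^ (n - 1) / of_nat (n - 1))) = h n * z ^ n" for n
    proof -
      consider "n = 0" | "n = 1" | m where "n = Suc (Suc m)" by (metis One_nat_def not0_implies_Suc)
      then show ?thesis
      proof cases
        case 3
        have "1 + of_nat m \<noteq> (0::complex)" "2 + of_nat m \<noteq> (0::complex)"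
          by (metis of_nat_Suc of_nat_eq_0_iff nat.distinct(1)) (metis of_nat_eq_0_iff nat.distinct(1) of_nat_numeral of_nat_add add_2_eq_Suc)
        then show ?thesis using 3 by (simp add: h_def field_simps)
      qed (auto simp: h_def)
    qed
    ultimately show ?thesis by simp
  qed
  have "f has_fps_expansion Abs_fps h"
    unfolding has_fps_expansion_def
  proof
    have "norm (1/2 :: complex) \<le> fps_conv_radius (Abs_fps h)"
      unfolding fps_conv_radius_def using s[of "1/2"]
      by (intro conv_radius_geI) (auto simp: sums_iff)
    then show "fps_conv_radius (Abs_fps h) > 0"
      by (rule less_le_trans[rotated]) (simp add: zero_ereal_def)
    have "eventually (\<lambda>z::complex. z \<in> ball 0 1) (nhds 0)"
      by (intro eventually_nhds_in_open) auto
    then show "eventually (\<lambda>z. eval_fps (Abs_fps h) z = f z) (nhds 0)"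
      by eventually_elim (use s in \<open>auto simp: eval_fps_def sums_iff\<close>)
  qed
  then have e: "fps_expansion f 0 = Abs_fps h" by (rule fps_expansion_eqI)
  show "taylor_coeff f n = (if n = 0 then 0 else if n = 1 then -1 else of_real (1 / (real (n-1) * real n)))"
    by (simp add: taylor_coeff_def e h_def)
  show "norm z < 1 \<Longrightarrow> (\<lambda>n. taylor_coeff f n * z ^ n) sums f z"
    using s by (simp add: taylor_coeff_def e)
qed

lemma kernel_le:
  assumes "\<alpha> > 0"
  shows "cesaro_kernel \<alpha> i \<le> cesaro_kernel (\<alpha> + 1) (n + i)"
proof -
  have "pochhammer \<alpha> i \<le> pochhammer (\<alpha> + 1) i"
    unfolding pochhammer_prod using assms by (intro prod_mono) auto
  then have le: "cesaro_kernel \<alpha> i \<le> cesaro_kernel (\<alpha> + 1) i"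
    by (simp add: cesaro_kernel_def divide_right_mono)
  have "cesaro_kernel (\<alpha> + 1) m \<le> cesaro_kernel (\<alpha> + 1) (Suc m)" for m
  proof -
    have "cesaro_kernel (\<alpha> + 1) (Suc m) = cesaro_kernel (\<alpha> + 1) m * ((\<alpha> + 1 + real m) / (1 + real m))"
      by (simp add: cesaro_kernel_def pochhammer_Suc field_simps)
    moreover have "(\<alpha> + 1 + real m) / (1 + real m) \<ge> 1" using assms by simp
    ultimately show ?thesis
      using mult_left_mono[of 1 "(\<alpha> + 1 + real m) / (1 + real m)" "cesaro_kernel (\<alpha> + 1) m"]
        kernel_nonneg[of "\<alpha> + 1" m] assms by simp
  qed
  then have "cesaro_kernel (\<alpha> + 1) i \<le> cesaro_kernel (\<alpha> + 1) (n + i)"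
    by (rule lift_Suc_mono_le) simp
  with le show ?thesis by (rule order_trans)
qed

lemma log_mem_weighted_disc_algebra:
  assumes "0 < \<alpha>"
  shows "(\<lambda>z. (1 - z) * Ln (1 - z)) \<in> weighted_disc_algebra \<alpha>"
proof -
  let ?f = "\<lambda>z. (1 - z) * Ln (1 - z)"
  define v where "v m = Beta (real m + 1) (\<alpha> + 2)" for m
  define k where "k = cesaro_kernel \<alpha>"
  define u1 where "u1 = -1 - (\<Sum>i. k (Suc i) * v i)"
  define u0 where "u0 = - (\<Sum>i. k (Suc i) * (if i = 0 then u1 else v (i - 1)))"
  define u where "u n = (if n = 0 then u0 else if n = 1 then u1 else v (n - 2))" for n
  have inv: "summable (\<lambda>n. 1 / ((real n + 1) * (real n + 2)))"
    proof -
    have "summable (\<lambda>n. 1 / real (Suc n) ^ 2)"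
      using inverse_power_summable[of 2, where 'a=real]
      by (subst summable_Suc_iff) (simp add: field_simps)
    then show ?thesis
      by (rule summable_comparison_test[rotated])
        (auto intro!: exI[of _ 0] divide_left_mono mult_mono simp: power2_eq_square)
  qed
  have u_sum: "summable (\<lambda>n. \<bar>u n\<bar> * cesaro_kernel (\<alpha> + 1) n)"
  proof (subst summable_iff_shift[symmetric, of _ 2])
    have "v n \<ge> 0" for n
      unfolding v_def Beta_def using assms by (simp add: Gamma_real_nonneg)
    then have "\<bar>u (n + 2)\<bar> * cesaro_kernel (\<alpha> + 1) (n + 2) = (\<alpha> + 1) * (1 / ((real n + 1) * (real n + 2)))" for n
      using kernel_Beta_prod[OF assms, of n] by (simp add: u_def v_def)
    then show "summable (\<lambda>n. \<bar>u (n + 2)\<bar> * cesaro_kernel (\<alpha> + 1) (n + 2))"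
      using summable_mult[OF inv] by presburger
  qed
  have ku: "summable (\<lambda>i. k i * u (n + i))" for n
  proof (rule summable_comparison_test)
    show "summable (\<lambda>i. \<bar>u (n + i)\<bar> * cesaro_kernel (\<alpha> + 1) (n + i))"
      using u_sum by (subst (asm) summable_iff_shift[symmetric, of _ n]) (simp add: add.commute)
    show "\<exists>N. \<forall>i\<ge>N. norm (k i * u (n + i)) \<le> \<bar>u (n + i)\<bar> * cesaro_kernel (\<alpha> + 1) (n + i)"
      using kernel_le[OF assms] kernel_nonneg[OF assms]
      by (intro exI[of _ 0])
        (simp add: abs_mult k_def mult.commute[of "\<bar>u _\<bar>"] mult_right_mono)
  qed
  have k0: "k 0 = 1" by (simp add: k_def cesaro_kernel_def)
  have split: "(\<Sum>i. k i * u (n + i)) = u n + (\<Sum>i. k (Suc i) * u (n + Suc i))" for n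
    using suminf_split_head[OF ku[of n]] k0 by simp
  have W: "(\<Sum>i. k i * u (n + i)) = (if n = 0 then 0 else if n = 1 then -1 else 1 / (real (n-1) * real n))" for n
  proof -
    consider "n = 0" | "n = 1" | m where "n = Suc (Suc m)" by (metis One_nat_def not0_implies_Suc)
    then show ?thesis
    proof cases
      case 1
      have "(\<lambda>i. k (Suc i) * u (Suc i)) = (\<lambda>i. k (Suc i) * (if i = 0 then u1 else v (i - 1)))"
        by (auto simp: u_def)
      then show ?thesis using 1 split[of 0] by (simp add: u_def[of 0] u0_def)
    next
      case 2
      then show ?thesis using split[of 1] by (simp add: u_def u1_def)
    next
      case 3
      have "(\<Sum>i. k i * v (m + i)) = Beta (real m + 1) 2"
        using kernel_Beta_sums[OF assms, of m] by (simp add: k_def v_def sums_iff)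
      then show ?thesis using 3 Beta_2[of m] by (simp add: u_def algebra_simps)
    qed
  qed
  have c: "taylor_coeff ?f = weyl_sum \<alpha> (\<lambda>n. of_real (u n))"
  proof
    fix n
    have "weyl_sum \<alpha> (\<lambda>n. of_real (u n)) n = of_real (\<Sum>i. k i * u (n + i))"
      using sums_of_real[OF summable_sums[OF ku[of n]], where 'a = complex]
      by (simp add: weyl_sum_def k_def sums_iff)
    then show "taylor_coeff ?f n = weyl_sum \<alpha> (\<lambda>n. of_real (u n)) n"
      by (simp add: W taylor_coeff_log(1))
  qed
  have h: "summable (\<lambda>n. norm (taylor_coeff ?f n))"
  proof (subst summable_iff_shift[symmetric, of _ 2])
    have "norm (taylor_coeff ?f (n + 2)) = 1 / ((real n + 1) * (real n + 2))" for n
      unfolding taylor_coeff_log(1) by (simp add: norm_divide norm_mult algebra_simps del: of_real_divide of_real_mult)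
    then show "summable (\<lambda>n. norm (taylor_coeff ?f (n + 2)))" using inv by simp
  qed
  have w: "summable (\<lambda>n. norm (complex_of_real (u n)) * cesaro_kernel (\<alpha> + 1) n)"
    using u_sum by simp
  have s: "\<forall>z\<in>ball 0 1. (\<lambda>n. taylor_coeff ?f n * z ^ n) sums ?f z"
    using taylor_coeff_log(2) by simp
  have "\<exists>u. summable (\<lambda>n. norm (u n) * cesaro_kernel (\<alpha> + 1) n) \<and>
      taylor_coeff ?f = weyl_sum \<alpha> u"
    by (rule exI, rule conjI, rule w, rule c)
  then show ?thesis
    unfolding weighted_disc_algebra_def mem_Collect_eq by (intro conjI s h)
qed

end

theory Submission
  imports Defs
begin

text \<open>
  Write \<open>L = [(1 - z) log (1 - z)](T)\<close> and \<open>A\<^sub>N = (\<Sum>i<N. T^i / (i + 1))\<close>, so that \<open>T A\<^sub>N x\<close> are the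
  partial sums of the logarithmic series. Since \<open>\<parallel>T^n\<parallel> = O(n^\<alpha>)\<close>, telescoping gives
  \<open>(I - T) T A\<^sub>N \<rightarrow> - L\<close>, hence convergence (even weak, by Hahn-Banach) of the series puts \<open>L x\<close> in the
  range of \<open>I - T\<close>.

  For the converse let \<open>z / - log (1 - z) = 1 - (\<Sum>n\<ge>1. b\<^sub>n z^n)\<close>. The numbers \<open>b\<^sub>n\<close> are nonnegative,
  decreasing and have sum at most \<open>1\<close>, so summation by parts and boundedness of the Cesaro means of \<open>T\<close>
  make \<open>G = I - (\<Sum>n\<ge>1. b\<^sub>n T^n)\<close> convergent in norm. The same argument applied to
  \<open>A\<^sub>N G = I - (\<Sum>m\<ge>N. c\<^sub>m T^m)\<close>, where \<open>c\<close> is nonnegative and decreasing with sum at most \<open>1\<close> and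
  \<open>c\<^sub>N = 1 / (N + 1)\<close>, shows that \<open>A\<^sub>N G\<close> is bounded uniformly in \<open>N\<close> and tends strongly to \<open>I\<close>. If
  \<open>L x = (I - T) y\<close>, then \<open>G y = - T x\<close> and therefore \<open>T A\<^sub>N x = - A\<^sub>N G y \<rightarrow> - y\<close>.
\<close>

subsection \<open>Complex functionals separate points\<close>

text \<open>Homogeneity is asked only as an inequality for positive \<open>t\<close>, which leaves
  one inequality to check for an infimum; equality follows by applying it to
  \<open>1 / t\<close>.\<close>

definition sublinear_functional :: "('a::real_vector \<Rightarrow> real) \<Rightarrow> bool" where
  "sublinear_functional p \<longleftrightarrow>
     (\<forall>x y. p (x + y) \<le> p x + p y) \<and> (\<forall>t x. 0 < t \<longrightarrow> p (t *\<^sub>R x) \<le> t * p x)"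

lemma sublinear_functionalD:
  assumes "sublinear_functional p"
  shows sublinear_functional_add: "p (x + y) \<le> p x + p y"
    and sublinear_functional_zero: "p 0 = 0"
    and sublinear_functional_scaleR: "0 \<le> t \<Longrightarrow> p (t *\<^sub>R x) = t * p x"
    and sublinear_functional_minus: "- p (- x) \<le> p x"
proof -
  have add: "p (x + y) \<le> p x + p y" and le: "0 < t \<Longrightarrow> p (t *\<^sub>R x) \<le> t * p x" for x y t
    using assms by (auto simp: sublinear_functional_def)
  show "p (x + y) \<le> p x + p y" by (rule add)
  show 0: "p 0 = 0"
    using add[of 0 0] le[of "1/2" 0] by simp
  show "p (t *\<^sub>R x) = t * p x" if "0 \<le> t"
  proof (cases "t = 0")
    case False
    then have "p x \<le> (1 / t) * p (t *\<^sub>R x)"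
      using le[of "1 / t" "t *\<^sub>R x"] that by simp
    then show ?thesis
      using le[of t x] that False by (simp add: field_simps)
  qed (use 0 in simp)
  show "- p (- x) \<le> p x"
    using add[of x "- x"] 0 by simp
qed

text \<open>For sublinear \<open>p\<close> this lies below \<open>p\<close> (take
  \<open>t = 0\<close>) and is at most \<open>- p v\<close> at \<open>- v\<close> (take
  \<open>t = 1\<close>), so a linear functional below it agrees with \<open>p\<close> at
  \<open>v\<close>.\<close>

definition tilt :: "('a::real_vector \<Rightarrow> real) \<Rightarrow> 'a \<Rightarrow> 'a \<Rightarrow> real" where
  "tilt p v y = (INF t\<in>{0..}. p (y + t *\<^sub>R v) - t * p v)"

text \<open>The infimum is finite: subadditivity gives
  \<open>t * p v \<le> p (- y) + p (y + t *\<^sub>R v)\<close>, hence the lower bound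
  \<open>- p (- y)\<close>.\<close>

lemma tilt_le:
  assumes "sublinear_functional p" "0 \<le> t"
  shows "tilt p v y \<le> p (y + t *\<^sub>R v) - t * p v"
  unfolding tilt_def
proof (rule cINF_lower)
  show "bdd_below ((\<lambda>t. p (y + t *\<^sub>R v) - t * p v) ` {0..})"
  proof (rule bdd_belowI2)
    fix t :: real assume "t \<in> {0..}"
    then show "- p (- y) \<le> p (y + t *\<^sub>R v) - t * p v"
      using sublinear_functional_add[OF assms(1), of "- y" "y + t *\<^sub>R v"]
        sublinear_functional_scaleR[OF assms(1), of t v] by simp
  qed
qed (use assms in simp)

lemma le_tilt:
  assumes "\<And>t. 0 \<le> t \<Longrightarrow> a \<le> p (y + t *\<^sub>R v) - t * p v"
  shows "a \<le> tilt p v y"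
  unfolding tilt_def by (rule cINF_greatest) (use assms in auto)

text \<open>Parameters \<open>t\<close> for \<open>x\<close> and \<open>s\<close> for
  \<open>y\<close> combine to \<open>t + s\<close> for \<open>x + y\<close>; for homogeneity
  \<open>t\<close> is rescaled to \<open>r * t\<close>.\<close>

lemma sublinear_functional_tilt:
  assumes p: "sublinear_functional p"
  shows "sublinear_functional (tilt p v)"
  unfolding sublinear_functional_def
proof (intro conjI allI impI)
  fix x y
  have "tilt p v (x + y) - (p (x + t *\<^sub>R v) - t * p v) \<le> tilt p v y" if t: "0 \<le> t" for t
  proof (rule le_tilt)
    fix s :: real assume s: "0 \<le> s"
    have "tilt p v (x + y) \<le> p (x + y + (t + s) *\<^sub>R v) - (t + s) * p v"
      by (rule tilt_le[OF p]) (use s t in simp)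
    also have "p (x + y + (t + s) *\<^sub>R v) \<le> p (x + t *\<^sub>R v) + p (y + s *\<^sub>R v)"
      using sublinear_functional_add[OF p, of "x + t *\<^sub>R v" "y + s *\<^sub>R v"]
      by (simp add: algebra_simps)
    finally show "tilt p v (x + y) - (p (x + t *\<^sub>R v) - t * p v) \<le> p (y + s *\<^sub>R v) - s * p v"
      by (simp add: algebra_simps)
  qed
  then have "tilt p v (x + y) - tilt p v y \<le> tilt p v x"
    by (intro le_tilt) (simp add: algebra_simps)
  then show "tilt p v (x + y) \<le> tilt p v x + tilt p v y" by simp
next
  fix r :: real and x assume r: "0 < r"
  have "tilt p v (r *\<^sub>R x) / r \<le> tilt p v x"
  proof (rule le_tilt)
    fix t :: real assume t: "0 \<le> t"
    have "tilt p v (r *\<^sub>R x) \<le> p (r *\<^sub>R x + (r * t) *\<^sub>R v) - r * t * p v"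
      by (rule tilt_le[OF p]) (use r t in simp)
    also have "r *\<^sub>R x + (r * t) *\<^sub>R v = r *\<^sub>R (x + t *\<^sub>R v)"
      by (simp add: algebra_simps)
    also have "p \<dots> = r * p (x + t *\<^sub>R v)"
      by (rule sublinear_functional_scaleR[OF p]) (use r in simp)
    finally show "tilt p v (r *\<^sub>R x) / r \<le> p (x + t *\<^sub>R v) - t * p v"
      using r by (simp add: field_simps)
  qed
  then show "tilt p v (r *\<^sub>R x) \<le> r * tilt p v x"
    using r by (simp add: field_simps)
qed

text \<open>A minimal sublinear functional coincides with all its tilts, which forces additivity.\<close>

theorem hahn_banach_dominated:
  fixes p :: "'a::real_vector \<Rightarrow> real"
  assumes p: "sublinear_functional p"
  shows "\<exists>f. linear f \<and> f \<le> p"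
proof -
  define A where "A = {q. sublinear_functional q \<and> q \<le> p}"
  \<comment> \<open>Zorn's lemma is applied to the reversed order, so that it yields a minimal
    functional; a nonempty chain is bounded by its pointwise infimum.\<close>
  have "\<exists>m\<in>A. \<forall>q\<in>A. q \<le> m \<longrightarrow> q = m"
  proof (rule predicate_Zorn)
    show "partial_order_on A (relation_of (\<lambda>q r. r \<le> q) A)"
      by (auto simp: partial_order_on_def preorder_on_def refl_on_def trans_def antisym_def
          relation_of_def)
  next
    fix C assume C: "C \<in> Chains (relation_of (\<lambda>q r. r \<le> q) A)"
    then have CA: "C \<subseteq> A" and lin: "\<And>q r. q \<in> C \<Longrightarrow> r \<in> C \<Longrightarrow> q \<le> r \<or> r \<le> q"
      by (auto simp: Chains_def relation_of_def)
    show "\<exists>u\<in>A. \<forall>q\<in>C. u \<le> q"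
    proof (cases "C = {}")
      case True
      then show ?thesis using p by (auto simp: A_def)
    next
      case False
      define u where "u x = (INF q\<in>C. q x)" for x
      have sub: "sublinear_functional q" "q \<le> p" if "q \<in> C" for q
        using that CA by (auto simp: A_def)
      have bdd: "bdd_below ((\<lambda>q. q x) ` C)" for x
      proof (rule bdd_belowI2)
        fix q assume q: "q \<in> C"
        show "- p (- x) \<le> q x"
          using sublinear_functional_minus[OF sub(1)[OF q], of x] le_funD[OF sub(2)[OF q], of "- x"]
          by simp
      qed
      have u_le: "u x \<le> q x" if "q \<in> C" for q x
        unfolding u_def by (rule cINF_lower[OF bdd that])
      have le_u: "a \<le> u x" if "\<And>q. q \<in> C \<Longrightarrow> a \<le> q x" for a x
        unfolding u_def by (rule cINF_greatest) (use False that in auto)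
      have "sublinear_functional u"
        unfolding sublinear_functional_def
      proof (intro conjI allI impI)
        fix x y
        have "u (x + y) - q x \<le> u y" if q: "q \<in> C" for q
        proof (rule le_u)
          fix r assume r: "r \<in> C"
          \<comment> \<open>The smaller of \<open>q\<close> and \<open>r\<close> reduces the claim
            to subadditivity of a single functional.\<close>
          then obtain s where s: "s \<in> C" "s \<le> q" "s \<le> r"
            using lin q by blast
          have "u (x + y) \<le> s x + s y"
            using u_le[OF s(1), of "x + y"] sublinear_functional_add[OF sub(1)[OF s(1)], of x y]
            by simp
          then show "u (x + y) - q x \<le> r y"
            using le_funD[OF s(2), of x] le_funD[OF s(3), of y] by simp
        qed
        then have "u (x + y) - u y \<le> u x"
          by (intro le_u) (simp add: algebra_simps)
        then show "u (x + y) \<le> u x + u y" by simp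
      next
        fix t :: real and x assume t: "0 < t"
        have "u (t *\<^sub>R x) / t \<le> u x"
        proof (rule le_u)
          fix q assume q: "q \<in> C"
          show "u (t *\<^sub>R x) / t \<le> q x"
            using u_le[OF q, of "t *\<^sub>R x"] sublinear_functional_scaleR[OF sub(1)[OF q], of t x] t
            by (simp add: field_simps)
        qed
        then show "u (t *\<^sub>R x) \<le> t * u x" using t by (simp add: field_simps)
      qed
      moreover have "u \<le> p"
        using False u_le sub(2) by (meson all_not_in_conv le_fun_def order_trans)
      ultimately show ?thesis
        using u_le by (auto simp: A_def le_fun_def)
    qed
  qed
  then obtain m where m: "sublinear_functional m" "m \<le> p"
    and min: "\<And>q. sublinear_functional q \<Longrightarrow> q \<le> m \<Longrightarrow> q = m"
    unfolding A_def by (auto intro: order_trans)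
  have add: "m (x + y) = m x + m y" for x y
  proof -
    have "tilt m y \<le> m"
      using tilt_le[OF m(1), of 0 y] by (auto simp: le_fun_def)
    then have "tilt m y = m"
      by (intro min sublinear_functional_tilt m(1))
    then show ?thesis
      using tilt_le[OF m(1), of 1 y x] sublinear_functional_add[OF m(1), of x y] by simp
  qed
  have minus: "m (- x) = - m x" for x
    using add[of x "- x"] sublinear_functional_zero[OF m(1)] by simp
  have "m (r *\<^sub>R x) = r * m x" for r x
  proof (cases "0 \<le> r")
    case False
    then show ?thesis
      using sublinear_functional_scaleR[OF m(1), of "- r" x] minus[of "r *\<^sub>R x"] by simp
  qed (simp add: sublinear_functional_scaleR[OF m(1)])
  then have "linear m"
    by (intro linearI) (simp_all add: add)
  with m(2) show ?thesis by blast
qed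

text \<open>Domination by the tilt of the norm at \<open>v\<close>, rather than by the norm itself,
  forces \<open>f (- v) \<le> - norm v\<close>; this replaces extending a functional from the line
  through \<open>v\<close>.\<close>

lemma bounded_linear_functional_nonzero:
  fixes v :: "'a::real_normed_vector"
  assumes "v \<noteq> 0"
  shows "\<exists>f :: 'a \<Rightarrow> real. bounded_linear f \<and> f v \<noteq> 0"
proof -
  have n: "sublinear_functional (norm :: 'a \<Rightarrow> real)"
    by (auto simp: sublinear_functional_def norm_triangle_ineq)
  obtain f where f: "linear f" and le: "f \<le> tilt norm v"
    using hahn_banach_dominated[OF sublinear_functional_tilt[OF n, of v]] by blast
  have "f x \<le> norm x" for x
    using le_funD[OF le, of x] tilt_le[OF n, of 0 v x] by simp
  then have "\<bar>f x\<bar> \<le> norm x" for x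
    using linear_neg[OF f, of x] by (metis abs_le_iff norm_minus_cancel)
  then have "bounded_linear f"
    using f by (intro bounded_linear_intro[where K = 1]) (auto simp: linear_add linear_scale)
  moreover have "f (- v) \<le> - norm v"
    using le_funD[OF le, of "- v"] tilt_le[OF n, of 1 v "- v"] by simp
  ultimately show ?thesis
    using assms linear_neg[OF f, of v] by force
qed

text \<open>The complexification \<open>f x - \<i> * f (\<i> *\<^sub>C x)\<close> of a real
  functional has real part \<open>f x\<close> and commutes with \<open>\<i>\<close>, hence with all
  complex scalars.\<close>

lemma bounded_clinear_functional_nonzero:
  fixes v :: "'a::complex_banach"
  assumes "v \<noteq> 0"
  shows "\<exists>\<phi> :: 'a \<Rightarrow> complex. bounded_clinear \<phi> \<and> \<phi> v \<noteq> 0"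
proof -
  obtain f :: "'a \<Rightarrow> real" where f: "bounded_linear f" and v: "f v \<noteq> 0"
    using bounded_linear_functional_nonzero[OF assms] by blast
  interpret f: bounded_linear f by (rule f)
  define \<phi> where "\<phi> x = of_real (f x) - \<i> * of_real (f (\<i> *\<^sub>C x))" for x
  have "bounded_linear (\<lambda>x. f (\<i> *\<^sub>C x))"
    by (rule bounded_linear_compose[OF f bounded_linear_scaleC])
  then have bl: "bounded_linear \<phi>"
    unfolding \<phi>_def
    by (intro bounded_linear_sub bounded_linear_compose[OF bounded_linear_of_real f]
        bounded_linear_compose[OF bounded_linear_mult_right]
        bounded_linear_compose[OF bounded_linear_of_real])
  have i: "\<phi> (\<i> *\<^sub>C x) = \<i> * \<phi> x" for x
  proof -
    have "\<i> *\<^sub>C \<i> *\<^sub>C x = - x"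
      using scaleC_of_real[of "-1" x] by (simp add: scaleC_scaleC)
    then show ?thesis by (simp add: \<phi>_def f.neg algebra_simps)
  qed
  interpret \<phi>: bounded_linear \<phi> by (rule bl)
  have "\<phi> (c *\<^sub>C x) = c * \<phi> x" for c x
  proof -
    have "c *\<^sub>C x = Re c *\<^sub>R x + Im c *\<^sub>R \<i> *\<^sub>C x"
      using scaleC_add_left[of "of_real (Re c)" "\<i> * of_real (Im c)" x]
      by (simp add: scaleC_scaleC mult.commute flip: scaleC_of_real complex_eq)
    then have "\<phi> (c *\<^sub>C x) = Re c *\<^sub>R \<phi> x + Im c *\<^sub>R (\<i> * \<phi> x)"
      by (simp add: \<phi>.add \<phi>.scale i)
    also have "\<dots> = c * \<phi> x"
      by (simp add: complex_eq_iff)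
    finally show ?thesis .
  qed
  moreover have "Re (\<phi> v) = f v"
    by (simp add: \<phi>_def)
  ultimately show ?thesis
    using bl v by (intro exI[of _ \<phi>]) (auto simp: bounded_clinear_def scaleC_complex_def)
qed

subsection \<open>Cesaro kernels and Gregory coefficients\<close>

lemma cesaro_kernel_0 [simp]: "cesaro_kernel \<alpha> 0 = 1"
  by (simp add: cesaro_kernel_def)

lemma cesaro_kernel_Suc:
  "cesaro_kernel \<alpha> (Suc n) = cesaro_kernel \<alpha> n * ((\<alpha> + real n) / (real n + 1))"
  by (simp add: cesaro_kernel_def pochhammer_Suc field_simps)

lemma cesaro_kernel_Suc_mult:
  "(real n + 1) * cesaro_kernel \<alpha> (Suc n) = (\<alpha> + real n) * cesaro_kernel \<alpha> n"
  by (simp add: cesaro_kernel_Suc)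

lemma cesaro_kernel_zero_left: "cesaro_kernel 0 n = (if n = 0 then 1 else 0)"
  by (simp add: cesaro_kernel_def pochhammer_0_left)

lemma cesaro_kernel_one_left [simp]: "cesaro_kernel 1 n = 1"
  by (simp add: cesaro_kernel_def pochhammer_fact[symmetric])

lemma cesaro_kernel_two_left: "cesaro_kernel 2 n = real n + 1"
  by (induction n) (simp_all add: cesaro_kernel_Suc)

text \<open>Coefficients of \<open>(1 - z) powr - \<alpha> * (1 - z) powr - \<beta>\<close>; the
  proof is the Vandermonde identity for \<open>pochhammer\<close>.\<close>

lemma cesaro_kernel_convolution:
  "(\<Sum>i\<le>n. cesaro_kernel \<alpha> i * cesaro_kernel \<beta> (n - i)) = cesaro_kernel (\<alpha> + \<beta>) n"
proof -
  have "cesaro_kernel (\<alpha> + \<beta>) n =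
      (\<Sum>i\<le>n. real (n choose i) * pochhammer \<alpha> i * pochhammer \<beta> (n - i) / fact n)"
    by (simp add: cesaro_kernel_def pochhammer_binomial_sum sum_divide_distrib)
  also have "\<dots> = (\<Sum>i\<le>n. cesaro_kernel \<alpha> i * cesaro_kernel \<beta> (n - i))"
    by (intro sum.cong) (auto simp: cesaro_kernel_def binomial_fact field_simps)
  finally show ?thesis by simp
qed

lemma sum_cesaro_kernel: "(\<Sum>i\<le>n. cesaro_kernel \<alpha> i) = cesaro_kernel (\<alpha> + 1) n"
  using cesaro_kernel_convolution[of \<alpha> 1 n] by simp

lemma cesaro_kernel_nonneg: "0 \<le> \<alpha> \<Longrightarrow> 0 \<le> cesaro_kernel \<alpha> n"
  using kernel_nonneg[of \<alpha> n] cesaro_kernel_zero_left[of n] by (cases "\<alpha> = 0") auto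

lemma cesaro_kernel_minus_nonpos:
  assumes "0 \<le> t" "t \<le> 1"
  shows "cesaro_kernel (- t) (Suc n) \<le> 0"
proof (induction n)
  case (Suc n)
  have "0 \<le> (- t + real (Suc n)) / (real (Suc n) + 1)"
    using assms by simp
  with Suc show ?case
    by (subst cesaro_kernel_Suc) (rule mult_nonpos_nonneg)
qed (use assms in \<open>simp add: cesaro_kernel_Suc\<close>)

lemma cesaro_kernel_minus_mono:
  assumes "0 \<le> t" "t \<le> 1"
  shows "cesaro_kernel (- t) (Suc n) \<le> cesaro_kernel (- t) (Suc (Suc n))"
proof -
  have "(- t + real (Suc n)) / (real (Suc n) + 1) \<le> 1"
    using assms by simp
  then show ?thesis
    using cesaro_kernel_minus_nonpos[OF assms, of n]
      mult_left_mono_neg[of "(- t + real (Suc n)) / (real (Suc n) + 1)" 1 "cesaro_kernel (- t) (Suc n)"]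
    by (simp add: cesaro_kernel_Suc[of _ "Suc n"])
qed

text \<open>\<open>cesaro_kernel (- t) n\<close> is the coefficient of \<open>z ^ n\<close> in
  \<open>(1 - z) powr t\<close>, and differentiating in \<open>t\<close> multiplies by
  \<open>ln (1 - z)\<close>. The induction follows the recursion of the kernel.\<close>

lemma has_derivative_cesaro_kernel_minus:
  "((\<lambda>t. cesaro_kernel (- t) n) has_real_derivative
     - (\<Sum>i<n. cesaro_kernel (- t) (n - 1 - i) / (real i + 1))) (at t)"
proof (induction n)
  case (Suc n)
  define q where "q = cesaro_kernel (- t)"
  define r where "r n = (\<Sum>i<n. q (n - 1 - i) / (real i + 1))" for n
  \<comment> \<open>Writing \<open>n + 1 = (n - i) + (i + 1)\<close> cancels the denominator in one
    part, while the kernel recursion lowers the index in the other; the leftover sums differ by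
    \<open>q n\<close>.\<close>
  have "(real n + 1) * r (Suc n) = (\<Sum>i\<le>n. (real n + 1) * (q (n - i) / (real i + 1)))"
    by (simp add: r_def sum_distrib_left lessThan_Suc_atMost)
  also have "\<dots> = (\<Sum>i\<le>n. real (n - i) * q (n - i) / (real i + 1) + q (n - i))"
    by (intro sum.cong) (auto simp: field_simps of_nat_diff)
  also have "\<dots> = (\<Sum>i<n. real (n - i) * q (n - i) / (real i + 1)) + (\<Sum>i\<le>n. q (n - i))"
    by (simp add: sum.distrib flip: lessThan_Suc_atMost)
  also have "(\<Sum>i<n. real (n - i) * q (n - i) / (real i + 1)) =
      (\<Sum>i<n. (real n - t) * (q (n - 1 - i) / (real i + 1)) - q (n - 1 - i))"
  proof (intro sum.cong refl)
    fix i assume "i \<in> {..<n}"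
    then have e: "n - i = Suc (n - 1 - i)" and n: "real (n - 1 - i) = real n - 1 - real i"
      by (auto simp: of_nat_diff)
    have "real (n - i) * q (n - i) = (real n - t - (real i + 1)) * q (n - 1 - i)"
      using cesaro_kernel_Suc_mult[of "n - 1 - i" "- t"] unfolding e q_def of_nat_Suc n
      by (simp add: algebra_simps)
    then show "real (n - i) * q (n - i) / (real i + 1) =
        (real n - t) * (q (n - 1 - i) / (real i + 1)) - q (n - 1 - i)"
      by (simp add: field_simps)
  qed
  also have "\<dots> = (real n - t) * r n - (\<Sum>i<n. q (n - Suc i))"
    by (simp add: r_def sum_subtractf sum_distrib_left)
  also have "(\<Sum>i<n. q (n - Suc i)) = (\<Sum>i<n. q i)"
    by (rule sum.nat_diff_reindex)
  also have "(\<Sum>i\<le>n. q (n - i)) = (\<Sum>i\<le>n. q i)"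
    using sum.nat_diff_reindex[of q "Suc n"] by (simp add: lessThan_Suc_atMost)
  finally have r: "(real n + 1) * r (Suc n) = (real n - t) * r n + q n"
    by (simp flip: lessThan_Suc_atMost)
  have "((\<lambda>t. cesaro_kernel (- t) n * ((- t + real n) / (real n + 1))) has_real_derivative
      - r n * ((- t + real n) / (real n + 1)) + (- 1 / (real n + 1)) * q n) (at t)"
    by (rule DERIV_mult[OF Suc[folded q_def r_def, unfolded q_def[symmetric], folded r_def], folded q_def])
      (auto intro!: derivative_eq_intros simp: divide_simps)
  also have "- r n * ((- t + real n) / (real n + 1)) + (- 1 / (real n + 1)) * q n = - r (Suc n)"
  proof -
    have "r (Suc n) = ((real n - t) * r n + q n) / (real n + 1)"
      using r by (simp add: field_simps)
    then show ?thesis unfolding divide_inverse by (simp add: algebra_simps)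
  qed
  finally show ?case
    by (simp add: cesaro_kernel_Suc q_def r_def)
qed (simp add: cesaro_kernel_def)

section \<open>Gregory coefficients: signs, monotonicity and sums\<close>

definition gregory :: "nat \<Rightarrow> real" where
  "gregory n = integral {0..1} (\<lambda>t. cesaro_kernel (- t) n)"

lemma integrable_cesaro_kernel_minus: "(\<lambda>t. cesaro_kernel (- t) n) integrable_on {0..1::real}"
  by (intro integrable_continuous_real continuous_at_imp_continuous_on ballI
      DERIV_isCont[OF has_derivative_cesaro_kernel_minus])

lemma gregory_0: "gregory 0 = 1"
  by (simp add: gregory_def)

lemma gregory_nonpos: "gregory (Suc n) \<le> 0"
  unfolding gregory_def
  using integral_le[OF integrable_cesaro_kernel_minus[of "Suc n"] integrable_0]
  by (simp add: cesaro_kernel_minus_nonpos)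

lemma gregory_mono: "gregory (Suc n) \<le> gregory (Suc (Suc n))"
  unfolding gregory_def
  by (intro integral_le integrable_cesaro_kernel_minus cesaro_kernel_minus_mono) auto

text \<open>For fixed \<open>t\<close> the kernels sum to \<open>cesaro_kernel (1 - t) K\<close>,
  which is nonnegative for \<open>t \<le> 1\<close>. Since \<open>gregory 0 = 1\<close>, the numbers
  \<open>- gregory n\<close> with \<open>n \<ge> 1\<close> have sum at most 1.\<close>

lemma sum_gregory_nonneg: "0 \<le> (\<Sum>n\<le>K. gregory n)"
proof -
  have "(\<Sum>n\<le>K. gregory n) = integral {0..1} (\<lambda>t. \<Sum>n\<le>K. cesaro_kernel (- t) n)"
    unfolding gregory_def
    by (rule integral_sum[symmetric]) (auto intro: integrable_cesaro_kernel_minus)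
  also have "\<dots> \<ge> 0"
  proof (rule integral_nonneg)
    show "(\<lambda>t. \<Sum>n\<le>K. cesaro_kernel (- t) n) integrable_on {0..1::real}"
      by (intro integrable_sum integrable_cesaro_kernel_minus) auto
  qed (auto simp: sum_cesaro_kernel intro: cesaro_kernel_nonneg)
  finally show ?thesis .
qed

text \<open>The generating function of the Gregory coefficients is \<open>z / - ln (1 - z)\<close>, the integral of
  \<open>(1 - z) powr t\<close> over \<open>t\<close> in \<open>[0, 1]\<close>.\<close>

lemma gregory_convolution:
  "(\<Sum>i\<le>m. gregory (m - i) / (real i + 1)) = (if m = 0 then 1 else 0)"
proof -
  \<comment> \<open>Integrating the derivative over \<open>[0, 1]\<close> leaves the coefficients of
    \<open>z ^ (m + 1)\<close> in \<open>1 - z\<close> and in \<open>1\<close>; only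
    \<open>m = 0\<close> gives a nonzero value.\<close>
  have "((\<lambda>t. - (\<Sum>i<Suc m. cesaro_kernel (- t) (Suc m - 1 - i) / (real i + 1))) has_integral
      cesaro_kernel (- 1) (Suc m) - cesaro_kernel (- 0) (Suc m)) {0..1}"
    by (rule fundamental_theorem_of_calculus[OF zero_le_one])
      (rule has_derivative_cesaro_kernel_minus[THEN has_field_derivative_at_within,
          unfolded has_real_derivative_iff_has_vector_derivative])
  from has_integral_neg[OF this]
  have "((\<lambda>t. \<Sum>i\<le>m. cesaro_kernel (- t) (m - i) / (real i + 1)) has_integral
      - cesaro_kernel (- 1) (Suc m)) {0..1}"
    unfolding lessThan_Suc_atMost by (simp add: cesaro_kernel_zero_left)
  moreover have "((\<lambda>t. \<Sum>i\<le>m. cesaro_kernel (- t) (m - i) / (real i + 1)) has_integral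
      (\<Sum>i\<le>m. gregory (m - i) / (real i + 1))) {0..1}"
    unfolding gregory_def
    by (rule has_integral_sum)
      (auto intro: has_integral_divide[OF integrable_integral[OF integrable_cesaro_kernel_minus]])
  ultimately have "(\<Sum>i\<le>m. gregory (m - i) / (real i + 1)) = - cesaro_kernel (- 1) (Suc m)"
    by (rule has_integral_unique[rotated])
  also have "cesaro_kernel (- 1) (Suc m) = (if m = 0 then - 1 else 0)"
    by (induction m) (simp_all add: cesaro_kernel_Suc)
  finally show ?thesis by simp
qed

lemma summable_gregory: "summable gregory"
proof -
  have "summable (\<lambda>n. - gregory (Suc n))"
  proof (rule bounded_imp_summable)
    fix n
    show "0 \<le> - gregory (Suc n)" using gregory_nonpos[of n] by simp
    have "(\<Sum>k\<le>Suc n. gregory k) = 1 + (\<Sum>k\<le>n. gregory (Suc k))"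
      unfolding sum.atMost_Suc_shift by (simp add: gregory_0)
    then show "(\<Sum>k\<le>n. - gregory (Suc k)) \<le> 1"
      using sum_gregory_nonneg[of "Suc n"] by (simp add: sum_negf)
  qed
  then show ?thesis
    by (simp add: summable_minus_iff summable_Suc_iff)
qed

subsection \<open>Summation by parts\<close>

lemma sum_scaleR_by_parts:
  fixes c :: "nat \<Rightarrow> real" and v :: "nat \<Rightarrow> 'a::real_vector"
  shows "(\<Sum>j\<le>K. c j *\<^sub>R v j) =
    c K *\<^sub>R (\<Sum>j\<le>K. v j) + (\<Sum>m<K. (c m - c (Suc m)) *\<^sub>R (\<Sum>j\<le>m. v j))"
  by (induction K) (simp_all add: algebra_simps)

text \<open>Abel summation with the nonnegative weights \<open>c m - c (Suc m)\<close>. The offset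
  \<open>N\<close> admits blocks of powers starting at \<open>T^N\<close>, whose sums are controlled
  relative to \<open>N + m + 1\<close>.\<close>

lemma norm_sum_scaleR_antimono_le:
  fixes c :: "nat \<Rightarrow> real" and v :: "nat \<Rightarrow> 'a::real_normed_vector"
  assumes v: "\<And>m. norm (\<Sum>j\<le>m. v j) \<le> B * (real N + real m + 1)"
    and c: "\<And>j. 0 \<le> c j" "\<And>j. c (Suc j) \<le> c j"
  shows "norm (\<Sum>j\<le>K. c j *\<^sub>R v j) \<le> B * (real N * c 0 + (\<Sum>j\<le>K. c j))"
proof -
  \<comment> \<open>The partial sums of \<open>\<beta>\<close> equal the assumed bounds exactly, so
    Abel summation can be undone for it.\<close>
  define \<beta> where "\<beta> j = B * (if j = 0 then real N + 1 else 1)" for j :: nat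
  have \<beta>: "(\<Sum>j\<le>m. \<beta> j) = B * (real N + real m + 1)" for m
    by (induction m) (simp_all add: \<beta>_def algebra_simps)
  have "norm (\<Sum>j\<le>K. c j *\<^sub>R v j) \<le>
      c K * norm (\<Sum>j\<le>K. v j) + (\<Sum>m<K. (c m - c (Suc m)) * norm (\<Sum>j\<le>m. v j))"
    unfolding sum_scaleR_by_parts[of c v]
    by (intro order_trans[OF norm_triangle_ineq] add_mono order_trans[OF norm_sum] sum_mono)
      (use c in auto)
  also have "\<dots> \<le> c K * (\<Sum>j\<le>K. \<beta> j) + (\<Sum>m<K. (c m - c (Suc m)) * (\<Sum>j\<le>m. \<beta> j))"
    unfolding \<beta> by (intro add_mono sum_mono mult_left_mono v) (use c in auto)
  also have "\<dots> = (\<Sum>j\<le>K. c j * \<beta> j)"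
    using sum_scaleR_by_parts[of c \<beta> K] by simp
  also have "\<dots> = B * (real N * c 0 + (\<Sum>j\<le>K. c j))"
    by (induction K) (simp_all add: \<beta>_def algebra_simps)
  finally show ?thesis .
qed

text \<open>For \<open>n \<ge> 2 * m\<close>, half of \<open>n * b n\<close> is at most
  \<open>(n - m) * b n\<close>, which monotonicity bounds by the sum over \<open>{m..<n}\<close>;
  the Cauchy criterion makes that small.\<close>

lemma antimono_summable_imp_index_mult_tendsto_zero:
  fixes b :: "nat \<Rightarrow> real"
  assumes b: "\<And>n. 0 \<le> b n" "decseq b" "summable b"
  shows "(\<lambda>n. real n * b n) \<longlonglongrightarrow> 0"
proof (rule LIMSEQ_I)
  fix e :: real assume e: "0 < e"
  obtain m where m: "\<And>n. norm (sum b {m..<n}) < e / 2"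
    using b(3)[unfolded summable_Cauchy, rule_format, of "e / 2"] e by auto
  have "norm (real n * b n - 0) < e" if n: "2 * m \<le> n" for n
  proof -
    have "(real n - real m) * b n = (\<Sum>j\<in>{m..<n}. b n)"
      using n by (simp add: of_nat_diff)
    also have "\<dots> \<le> sum b {m..<n}"
      by (intro sum_mono) (use b(2) in \<open>auto simp: decseq_def\<close>)
    also have "\<dots> < e / 2" using m[of n] by simp
    finally have "2 * (real n - real m) * b n < e" by (simp add: algebra_simps)
    moreover have "real n * b n \<le> 2 * (real n - real m) * b n"
      by (intro mult_right_mono b) (use of_nat_mono[OF n, where 'a = real] in simp)
    ultimately show ?thesis using b(1)[of n] by simp
  qed
  then show "\<exists>n0. \<forall>n\<ge>n0. norm (real n * b n - 0) < e" by blast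
qed

subsection \<open>Operators with bounded Cesaro means\<close>

interpretation blinfun_compose: bounded_bilinear "(o\<^sub>L)"
  by (rule bounded_bilinear_blinfun_compose)

lemma blinfun_pow_add: "blinfun_pow T (m + n) = blinfun_pow T m o\<^sub>L blinfun_pow T n"
  by (induction m) (auto intro!: blinfun_eqI)

lemma blinfun_pow_compose_self: "blinfun_pow T n o\<^sub>L T = blinfun_pow T (Suc n)"
proof -
  have "blinfun_pow T 1 = T" by (auto intro: blinfun_eqI)
  then show ?thesis using blinfun_pow_add[of T n 1] by simp
qed

lemma blinfun_pow_apply_commute:
  "blinfun_pow T m (blinfun_pow T n x) = blinfun_pow T n (blinfun_pow T m x)"
  using blinfun_pow_add[of T m n] blinfun_pow_add[of T n m]
  by (metis add.commute blinfun_apply_blinfun_compose)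

text \<open>An eventual uniform bound carries strong convergence from \<open>D\<close> to its
  closure. It serves for the remainders \<open>I - A\<^sub>N G\<close> and for the Cesaro means,
  both with the range of \<open>I - T\<close> as \<open>D\<close>.\<close>

lemma tendsto_zero_on_closure:
  fixes A :: "nat \<Rightarrow> 'a::real_normed_vector \<Rightarrow>\<^sub>L 'b::real_normed_vector"
  assumes bound: "\<forall>\<^sub>F n in sequentially. norm (A n) \<le> K"
    and D: "\<And>d. d \<in> D \<Longrightarrow> (\<lambda>n. A n d) \<longlonglongrightarrow> 0"
    and x: "x \<in> closure D"
  shows "(\<lambda>n. A n x) \<longlonglongrightarrow> 0"
proof (rule tendstoI)
  fix e :: real assume e: "0 < e"
  define \<delta> where "\<delta> = e / (2 * (\<bar>K\<bar> + 1))"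
  have \<delta>: "0 < \<delta>" using e by (simp add: \<delta>_def)
  then obtain d where d: "d \<in> D" "dist d x < \<delta>"
    using x by (auto simp: closure_approachable)
  have "\<forall>\<^sub>F n in sequentially. norm (A n d) < e / 2"
    using tendstoD[OF D[OF d(1)], of "e / 2"] e by simp
  with bound show "\<forall>\<^sub>F n in sequentially. dist (A n x) 0 < e"
  proof eventually_elim
    case (elim n)
    have "norm (A n (x - d)) \<le> norm (A n) * norm (x - d)"
      by (rule norm_blinfun)
    also have "\<dots> \<le> (\<bar>K\<bar> + 1) * \<delta>"
      by (intro mult_mono) (use elim d in \<open>auto simp: dist_norm norm_minus_commute\<close>)
    also have "\<dots> = e / 2"
      by (simp add: \<delta>_def field_simps)
    finally have "norm (A n (x - d)) + norm (A n d) < e"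
      using elim by simp
    moreover have "A n x = A n (x - d) + A n d"
      by (simp add: blinfun.diff_right)
    ultimately show ?case
      using norm_triangle_ineq[of "A n (x - d)" "A n d"] by simp
  qed
qed

lemma norm_sums_le:
  fixes f :: "nat \<Rightarrow> 'a::real_normed_vector"
  assumes "f sums s" "\<And>K. norm (\<Sum>j\<le>K. f j) \<le> C"
  shows "norm s \<le> C"
  by (rule LIMSEQ_le_const2[OF tendsto_norm[OF assms(1)[unfolded sums_def_le]]]) (use assms(2) in blast)

text \<open>The tail coefficients of the product of \<open>\<Sum>i<N. z ^ i / (i + 1)\<close> with the Gregory series
  \<open>z / - ln (1 - z)\<close>; this product is \<open>1 - (\<Sum>j. remainder_coeff N j * z ^ (N + j))\<close>.\<close>

definition remainder_coeff :: "nat \<Rightarrow> nat \<Rightarrow> real" where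
  "remainder_coeff N j = (\<Sum>i<N. - gregory (N + j - i) / (real i + 1))"

text \<open>The whole coefficient sequence of the product whose negated tail is
  \<open>remainder_coeff\<close>.\<close>

definition truncated_convolution :: "nat \<Rightarrow> nat \<Rightarrow> real" where
  "truncated_convolution N m = (\<Sum>i<N. if i \<le> m then gregory (m - i) / (real i + 1) else 0)"

text \<open>Below degree \<open>N\<close> the truncation is not felt, and the coefficients are those
  of \<open>(- ln (1 - z) / z) * (z / - ln (1 - z)) = 1\<close>.\<close>

lemma truncated_convolution_less:
  assumes "m < N"
  shows "truncated_convolution N m = (if m = 0 then 1 else 0)"
proof -
  have "truncated_convolution N m = (\<Sum>i\<le>m. gregory (m - i) / (real i + 1))"
    unfolding truncated_convolution_def using assms
    by (intro sum.mono_neutral_cong_right) auto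
  then show ?thesis by (simp add: gregory_convolution)
qed

lemma truncated_convolution_ge: "truncated_convolution N (N + j) = - remainder_coeff N j"
  unfolding truncated_convolution_def remainder_coeff_def sum_negf[symmetric]
  by (intro sum.cong) auto

lemma remainder_coeff_nonneg: "0 \<le> remainder_coeff N j"
  unfolding remainder_coeff_def
proof (intro sum_nonneg divide_nonneg_nonneg)
  fix i assume "i \<in> {..<N}"
  then have "N + j - i = Suc (N + j - i - 1)" by simp
  then show "0 \<le> - gregory (N + j - i)" using gregory_nonpos by (metis neg_0_le_iff_le)
qed auto

lemma remainder_coeff_antimono: "remainder_coeff N (Suc j) \<le> remainder_coeff N j"
  unfolding remainder_coeff_def
proof (intro sum_mono divide_right_mono)
  fix i assume "i \<in> {..<N}"
  then have "N + j - i = Suc (N + j - i - 1)" "N + Suc j - i = Suc (Suc (N + j - i - 1))" by auto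
  then show "- gregory (N + Suc j - i) \<le> - gregory (N + j - i)"
    using gregory_mono by (metis neg_le_iff_le)
qed auto

text \<open>In degree \<open>N > 0\<close> the full convolution vanishes, and truncation drops only
  the term \<open>i = N\<close>, which is \<open>gregory 0 / (N + 1)\<close>.\<close>

lemma remainder_coeff_0:
  assumes "0 < N"
  shows "remainder_coeff N 0 = 1 / (real N + 1)"
proof -
  have "0 = (\<Sum>i\<le>N. gregory (N - i) / (real i + 1))"
    using assms by (simp add: gregory_convolution)
  also have "\<dots> = (\<Sum>i<N. gregory (N - i) / (real i + 1)) + 1 / (real N + 1)"
    by (simp add: gregory_0 flip: lessThan_Suc_atMost)
  finally show ?thesis
    by (simp add: remainder_coeff_def sum_negf)
qed

text \<open>The coefficients of the product up to degree \<open>N + K\<close> sum to 1 minus the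
  left side. Summed in the other order they are a positive combination of partial sums of
  \<open>gregory\<close>, hence nonnegative.\<close>

lemma sum_remainder_coeff_le:
  assumes "0 < N"
  shows "(\<Sum>j\<le>K. remainder_coeff N j) \<le> 1"
proof -
  have "(\<Sum>m\<le>N + K. truncated_convolution N m) =
      (\<Sum>i<N. (\<Sum>m\<le>N + K. if i \<le> m then gregory (m - i) / (real i + 1) else 0))"
    unfolding truncated_convolution_def by (rule sum.swap)
  also have "\<dots> = (\<Sum>i<N. (\<Sum>n\<le>N + K - i. gregory n) / (real i + 1))"
  proof (intro sum.cong refl)
    fix i assume "i \<in> {..<N}"
    then have i: "i \<le> N + K" by simp
    have "(\<Sum>m\<le>N + K. if i \<le> m then gregory (m - i) / (real i + 1) else 0) =
        (\<Sum>m\<in>{i..N + K}. gregory (m - i) / (real i + 1))"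
      by (intro sum.mono_neutral_cong_right) auto
    also have "\<dots> = (\<Sum>n\<in>{..N + K - i}. gregory n / (real i + 1))"
      by (rule sum.reindex_bij_witness[of _ "\<lambda>n. n + i" "\<lambda>m. m - i"]) (use i in auto)
    finally show "(\<Sum>m\<le>N + K. if i \<le> m then gregory (m - i) / (real i + 1) else 0) =
        (\<Sum>n\<le>N + K - i. gregory n) / (real i + 1)"
      by (simp add: sum_divide_distrib)
  qed
  also have "\<dots> \<ge> 0"
    by (intro sum_nonneg divide_nonneg_nonneg sum_gregory_nonneg) auto
  finally have "0 \<le> (\<Sum>m\<le>N + K. truncated_convolution N m)" .
  also have "{..N + K} = {..<N} \<union> {N..N + K}" by auto
  also have "sum (truncated_convolution N) \<dots> =
      (\<Sum>m<N. truncated_convolution N m) + (\<Sum>m\<in>{N..N + K}. truncated_convolution N m)"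
    by (rule sum.union_disjoint) auto
  also have "(\<Sum>m<N. truncated_convolution N m) = (\<Sum>m<N. if m = 0 then 1 else 0)"
    by (intro sum.cong) (auto simp: truncated_convolution_less)
  also have "\<dots> = 1" using assms by simp
  also have "(\<Sum>m\<in>{N..N + K}. truncated_convolution N m) = (\<Sum>j\<le>K. - remainder_coeff N j)"
    by (rule sum.reindex_bij_witness[of _ "\<lambda>j. N + j" "\<lambda>m. m - N"])
      (auto simp flip: truncated_convolution_ge)
  finally show ?thesis by (simp add: sum_negf)
qed

text \<open>This is the combination that appears in \<open>norm_sum_scaleR_antimono_le\<close>,
  controlled uniformly in \<open>N\<close> and \<open>K\<close>.\<close>

lemma remainder_coeff_total_le:
  assumes "0 < N"
  shows "real N * remainder_coeff N 0 + (\<Sum>j\<le>K. remainder_coeff N j) \<le> 2"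
proof -
  have "real N * remainder_coeff N 0 \<le> 1"
    by (simp add: remainder_coeff_0[OF assms])
  then show ?thesis
    using sum_remainder_coeff_le[OF assms, of K] by simp
qed

text \<open>The Taylor coefficients of \<open>(1 - z) * ln (1 - z)\<close>.\<close>

definition log_coeff :: "nat \<Rightarrow> real" where
  "log_coeff n = (if n = 0 then 0 else if n = 1 then -1 else 1 / (real (n - 1) * real n))"

section \<open>The operators \<open>G\<close> and \<open>A\<^sub>N\<close> when the means of
  \<open>T\<close> are bounded and \<open>T^n\<close> has norm \<open>o(n)\<close>\<close>

locale cesaro_mean_bounded =
  fixes T :: "'a::banach \<Rightarrow>\<^sub>L 'a" and B :: real
  assumes norm_sum_pow_le: "\<And>n. norm (\<Sum>j\<le>n. blinfun_pow T j) \<le> B * (real n + 1)"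
    and pow_div_tendsto_zero: "(\<lambda>n. norm (blinfun_pow T n) / (real n + 1)) \<longlonglongrightarrow> 0"
begin

lemma bound_nonneg: "0 \<le> B"
  using order_trans[OF norm_ge_zero norm_sum_pow_le[of 0]] by simp

lemma norm_sum_pow_shift_le:
  "norm (\<Sum>j\<le>m. blinfun_pow T (N + j)) \<le> 2 * B * (real N + real m + 1)"
proof (cases N)
  case 0
  have "B * (real m + 1) \<le> 2 * B * (real m + 1)"
    using bound_nonneg by (intro mult_right_mono) auto
  then show ?thesis using 0 norm_sum_pow_le[of m] by simp
next
  case (Suc k)
  have "(\<Sum>j\<le>m. blinfun_pow T (N + j)) =
      (\<Sum>j\<le>N + m. blinfun_pow T j) - (\<Sum>j\<le>k. blinfun_pow T j)"
    by (induction m) (simp_all add: Suc del: blinfun_pow.simps)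
  then have "norm (\<Sum>j\<le>m. blinfun_pow T (N + j)) \<le> B * (real (N + m) + 1) + B * (real k + 1)"
    by (simp only:) (intro order_trans[OF norm_triangle_ineq4] add_mono norm_sum_pow_le)
  also have "\<dots> = B * (real (N + m) + 1 + (real k + 1))" by (simp add: algebra_simps)
  also have "\<dots> \<le> B * (2 * (real N + real m + 1))"
    using bound_nonneg Suc by (intro mult_left_mono) auto
  finally show ?thesis by (simp add: algebra_simps)
qed

text \<open>The available bounds do not give absolute convergence. Summation by parts on blocks
  gives the Cauchy estimate \<open>g m\<close>, which tends to 0 because \<open>m * b m\<close> and
  the tails of \<open>b\<close> do.\<close>

lemma summable_gregory_pow: "summable (\<lambda>n. gregory n *\<^sub>R blinfun_pow T n)"
proof -
  define b where "b n = - gregory (Suc n)" for n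
  have b: "\<And>n. 0 \<le> b n" "\<And>n. b (Suc n) \<le> b n" "summable b"
    using gregory_nonpos gregory_mono summable_minus[OF summable_ignore_initial_segment[OF summable_gregory, of 1]]
    by (simp_all add: b_def[abs_def])
  define g where "g m = 2 * B * (real (Suc m) * b m + (\<Sum>k. b (k + m)))" for m
  have "summable (\<lambda>n. b n *\<^sub>R blinfun_pow T (Suc n))"
  proof (rule summable_Cauchy'[where g = g])
    have "norm (\<Sum>j\<in>{m..<n}. b j *\<^sub>R blinfun_pow T (Suc j)) \<le> g m" if "m \<le> n" for m n
    proof (cases "n = m")
      case True
      then show ?thesis
        using bound_nonneg b summable_ignore_initial_segment[OF b(3), of m]
        by (simp add: g_def suminf_nonneg)
    next
      case False
      define K where "K = n - m - 1"
      have n: "n = Suc (m + K)" using that False by (simp add: K_def)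
      have "(\<Sum>j\<in>{m..<n}. b j *\<^sub>R blinfun_pow T (Suc j)) =
          (\<Sum>j\<le>K. b (m + j) *\<^sub>R blinfun_pow T (Suc m + j))"
        by (rule sum.reindex_bij_witness[of _ "\<lambda>j. m + j" "\<lambda>j. j - m"]) (auto simp: n)
      also have "norm \<dots> \<le> 2 * B * (real (Suc m) * b (m + 0) + (\<Sum>j\<le>K. b (m + j)))"
        using b by (intro norm_sum_scaleR_antimono_le norm_sum_pow_shift_le) auto
      also have "(\<Sum>j\<le>K. b (m + j)) \<le> (\<Sum>k. b (k + m))"
        using sum_le_suminf[OF summable_ignore_initial_segment[OF b(3), of m], of "{..K}"] b
        by (simp add: add.commute)
      finally show ?thesis
        using bound_nonneg by (simp add: g_def mult_left_mono)
    qed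
    then show "\<forall>\<^sub>F m in sequentially. \<forall>n\<ge>m.
        norm (\<Sum>j\<in>{m..<n}. b j *\<^sub>R blinfun_pow T (Suc j)) \<le> g m"
      by simp
    have "(\<lambda>m. real m * b m) \<longlonglongrightarrow> 0"
      by (rule antimono_summable_imp_index_mult_tendsto_zero) (use b in \<open>auto intro: decseq_SucI\<close>)
    then have "(\<lambda>m. 2 * B * (real m * b m + b m + (\<Sum>k. b (k + m)))) \<longlonglongrightarrow> 2 * B * (0 + 0 + 0)"
      by (intro tendsto_mult tendsto_add tendsto_const suminf_exist_split2 b
          summable_LIMSEQ_zero[OF b(3)])
    then show "g \<longlonglongrightarrow> 0"
      by (simp add: g_def[abs_def] algebra_simps)
  qed
  then have "summable (\<lambda>n. gregory (Suc n) *\<^sub>R blinfun_pow T (Suc n))"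
    using summable_minus_iff[of "\<lambda>n. b n *\<^sub>R blinfun_pow T (Suc n)"] by (simp add: b_def)
  then show ?thesis
    by (subst (asm) summable_Suc_iff)
qed

text \<open>The operator \<open>G\<close> of the overview, that is \<open>z / - ln (1 - z)\<close>
  at \<open>T\<close>. Below, \<open>log_partial N\<close> is \<open>A\<^sub>N\<close>, and
  \<open>log_remainder N\<close> is the error \<open>I - A\<^sub>N G\<close>.\<close>

definition gregory_op :: "'a \<Rightarrow>\<^sub>L 'a" where
  "gregory_op = (\<Sum>n. gregory n *\<^sub>R blinfun_pow T n)"

definition log_partial :: "nat \<Rightarrow> 'a \<Rightarrow>\<^sub>L 'a" where
  "log_partial N = (\<Sum>i<N. (1 / (real i + 1)) *\<^sub>R blinfun_pow T i)"

definition log_remainder :: "nat \<Rightarrow> 'a \<Rightarrow>\<^sub>L 'a" where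
  "log_remainder N = id_blinfun - (log_partial N o\<^sub>L gregory_op)"

lemma gregory_op_sums: "(\<lambda>n. gregory n *\<^sub>R blinfun_pow T n) sums gregory_op"
  unfolding gregory_op_def by (rule summable_sums[OF summable_gregory_pow])

lemma gregory_op_pow_commute: "gregory_op (blinfun_pow T i x) = blinfun_pow T i (gregory_op x)"
proof (rule sums_unique2)
  show "(\<lambda>n. gregory n *\<^sub>R blinfun_pow T n (blinfun_pow T i x)) sums gregory_op (blinfun_pow T i x)"
    using bounded_linear.sums[OF blinfun.bounded_linear_left gregory_op_sums]
    by (simp add: blinfun.scaleR_left)
  have "(\<lambda>n. gregory n *\<^sub>R blinfun_pow T n x) sums gregory_op x"
    using bounded_linear.sums[OF blinfun.bounded_linear_left gregory_op_sums]
    by (simp add: blinfun.scaleR_left)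
  from bounded_linear.sums[OF blinfun.bounded_linear_right this, of "blinfun_pow T i"]
  show "(\<lambda>n. gregory n *\<^sub>R blinfun_pow T n (blinfun_pow T i x)) sums blinfun_pow T i (gregory_op x)"
    by (simp add: blinfun.scaleR_right blinfun_pow_apply_commute[of T i])
qed

lemma gregory_op_commute: "gregory_op (T x) = T (gregory_op x)"
  using gregory_op_pow_commute[of 1 x] by simp

lemma log_partial_commute: "log_partial N (T x) = T (log_partial N x)"
  using blinfun_pow_apply_commute[of T _ 1 x]
  by (simp add: log_partial_def blinfun.sum_left blinfun.scaleR_left blinfun.sum_right
      blinfun.scaleR_right)

lemma log_partial_gregory_op_commute:
  "log_partial N (gregory_op x) = gregory_op (log_partial N x)"
  by (simp add: log_partial_def blinfun.sum_left blinfun.scaleR_left blinfun.sum_right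
      blinfun.scaleR_right gregory_op_pow_commute)

text \<open>One factor is a finite sum, so the product series is a sum of finitely many shifted
  copies of the convergent series for \<open>G\<close>; this regrouping is valid without absolute
  convergence.\<close>

lemma log_partial_compose_gregory_op_sums:
  "(\<lambda>m. truncated_convolution N m *\<^sub>R blinfun_pow T m) sums (log_partial N o\<^sub>L gregory_op)"
proof -
  have "(\<lambda>m. if i \<le> m then (gregory (m - i) / (real i + 1)) *\<^sub>R blinfun_pow T m else 0) sums
      ((1 / (real i + 1)) *\<^sub>R (blinfun_pow T i o\<^sub>L gregory_op))" (is "?f sums ?s") for i
  proof -
    have "(\<lambda>n. (1 / (real i + 1)) *\<^sub>R (blinfun_pow T i o\<^sub>L (gregory n *\<^sub>R blinfun_pow T n))) sums ?s"
      by (intro sums_scaleR_right bounded_linear.sums[OF blinfun_compose.bounded_linear_right]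
          gregory_op_sums)
    also have "(\<lambda>n. (1 / (real i + 1)) *\<^sub>R (blinfun_pow T i o\<^sub>L (gregory n *\<^sub>R blinfun_pow T n))) =
        (\<lambda>n. ?f (n + i))"
      by (simp add: blinfun_compose.scaleR_right add.commute[of _ i] flip: blinfun_pow_add)
    finally have "?f sums (?s + (\<Sum>m<i. ?f m))"
      by (rule sums_iff_shift[THEN iffD1])
    then show ?thesis by simp
  qed
  then have "(\<lambda>m. \<Sum>i<N. if i \<le> m then (gregory (m - i) / (real i + 1)) *\<^sub>R blinfun_pow T m else 0)
      sums (\<Sum>i<N. (1 / (real i + 1)) *\<^sub>R (blinfun_pow T i o\<^sub>L gregory_op))"
    by (intro sums_sum)
  moreover have "(\<Sum>i<N. if i \<le> m then (gregory (m - i) / (real i + 1)) *\<^sub>R blinfun_pow T m else 0) =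
      truncated_convolution N m *\<^sub>R blinfun_pow T m" for m
    unfolding truncated_convolution_def scaleR_sum_left by (intro sum.cong) auto
  ultimately show ?thesis
    by (simp add: log_partial_def blinfun_compose.sum_left blinfun_compose.scaleR_left)
qed

lemma log_remainder_sums:
  assumes "0 < N"
  shows "(\<lambda>j. remainder_coeff N j *\<^sub>R blinfun_pow T (N + j)) sums log_remainder N"
proof -
  have "(\<Sum>m<N. truncated_convolution N m *\<^sub>R blinfun_pow T m) =
      (\<Sum>m<N. if m = 0 then id_blinfun else 0)"
    by (intro sum.cong) (auto simp: truncated_convolution_less)
  also have "\<dots> = id_blinfun" using assms by simp
  finally have "(\<lambda>j. truncated_convolution N (j + N) *\<^sub>R blinfun_pow T (j + N)) sums
      ((log_partial N o\<^sub>L gregory_op) - id_blinfun)"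
    using sums_split_initial_segment[OF log_partial_compose_gregory_op_sums, of N N] by simp
  from sums_minus[OF this] show ?thesis
    by (simp add: log_remainder_def add.commute[of _ N] truncated_convolution_ge)
qed

text \<open>Abel summation with block bound \<open>2 * B\<close> and total weight at most 2.
  Uniformity in \<open>N\<close> is what later carries the limit to the closure of the range of
  \<open>I - T\<close>.\<close>

lemma norm_log_remainder_le:
  assumes "0 < N"
  shows "norm (log_remainder N) \<le> 4 * B"
proof (rule norm_sums_le[OF log_remainder_sums[OF assms]])
  fix K
  have "norm (\<Sum>j\<le>K. remainder_coeff N j *\<^sub>R blinfun_pow T (N + j)) \<le>
      2 * B * (real N * remainder_coeff N 0 + (\<Sum>j\<le>K. remainder_coeff N j))"
    by (rule norm_sum_scaleR_antimono_le)
      (use norm_sum_pow_shift_le remainder_coeff_nonneg remainder_coeff_antimono in auto)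
  also have "\<dots> \<le> 2 * B * 2"
    using remainder_coeff_total_le[OF assms] bound_nonneg by (intro mult_left_mono) auto
  finally show "norm (\<Sum>j\<le>K. remainder_coeff N j *\<^sub>R blinfun_pow T (N + j)) \<le> 4 * B"
    by simp
qed

text \<open>After composition with \<open>I - T\<close> the block sums telescope to
  \<open>T^N - T^(N + m + 1)\<close>, so the same estimate holds with \<open>3 * e\<close> in place
  of \<open>2 * B\<close>.\<close>

lemma norm_log_remainder_compose_le:
  assumes N: "0 < N" and e: "\<And>n. N \<le> n \<Longrightarrow> norm (blinfun_pow T n) \<le> e * (real n + 1)"
  shows "norm (log_remainder N o\<^sub>L (id_blinfun - T)) \<le> 6 * e"
proof (rule norm_sums_le)
  let ?v = "\<lambda>j. blinfun_pow T (N + j) o\<^sub>L (id_blinfun - T)"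
  show "(\<lambda>j. remainder_coeff N j *\<^sub>R ?v j) sums (log_remainder N o\<^sub>L (id_blinfun - T))"
    using bounded_linear.sums[OF blinfun_compose.bounded_linear_left log_remainder_sums[OF N]]
    by (simp add: blinfun_compose.scaleR_left)
  have e0: "0 \<le> e"
    using order_trans[OF norm_ge_zero e[of N]] by (simp add: zero_le_mult_iff)
  fix K
  have "norm (\<Sum>j\<le>K. remainder_coeff N j *\<^sub>R ?v j) \<le>
      3 * e * (real N * remainder_coeff N 0 + (\<Sum>j\<le>K. remainder_coeff N j))"
  proof (rule norm_sum_scaleR_antimono_le)
    fix m
    show "0 \<le> remainder_coeff N m" "remainder_coeff N (Suc m) \<le> remainder_coeff N m"
      by (rule remainder_coeff_nonneg remainder_coeff_antimono)+
    have v: "?v j = blinfun_pow T (N + j) - blinfun_pow T (Suc (N + j))" for j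
      unfolding blinfun_compose.diff_right blinfun_pow_compose_self by (auto intro!: blinfun_eqI)
    have "(\<Sum>j\<le>m. ?v j) = blinfun_pow T N - blinfun_pow T (Suc (N + m))"
      unfolding v by (induction m) (simp_all del: blinfun_pow.simps)
    also have "norm \<dots> \<le> e * (real N + 1) + e * (real (Suc (N + m)) + 1)"
      by (intro order_trans[OF norm_triangle_ineq4] add_mono e) auto
    also have "\<dots> = e * (2 * real N + real m + 3)" by (simp add: algebra_simps)
    also have "\<dots> \<le> e * (3 * (real N + real m + 1))"
      using e0 by (intro mult_left_mono) auto
    finally show "norm (\<Sum>j\<le>m. ?v j) \<le> 3 * e * (real N + real m + 1)"
      by (simp add: algebra_simps)
  qed
  also have "\<dots> \<le> 3 * e * 2"
    using remainder_coeff_total_le[OF N] e0 by (intro mult_left_mono) auto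
  finally show "norm (\<Sum>j\<le>K. remainder_coeff N j *\<^sub>R ?v j) \<le> 6 * e" by simp
qed

lemma log_remainder_compose_tendsto_zero:
  "(\<lambda>N. log_remainder N o\<^sub>L (id_blinfun - T)) \<longlonglongrightarrow> 0"
proof (rule tendstoI)
  fix e :: real assume e: "0 < e"
  obtain N0 where N0: "\<And>n. N0 \<le> n \<Longrightarrow> norm (blinfun_pow T n) / (real n + 1) < e / 12"
    using tendstoD[OF pow_div_tendsto_zero, of "e / 12"] e
    by (auto simp: eventually_sequentially)
  show "\<forall>\<^sub>F N in sequentially. dist (log_remainder N o\<^sub>L (id_blinfun - T)) 0 < e"
    using eventually_ge_at_top[of "Suc N0"]
  proof eventually_elim
    case (elim N)
    have "norm (log_remainder N o\<^sub>L (id_blinfun - T)) \<le> 6 * (e / 12)"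
    proof (rule norm_log_remainder_compose_le)
      show "norm (blinfun_pow T n) \<le> e / 12 * (real n + 1)" if "N \<le> n" for n
        using N0[of n] that elim by (simp add: pos_divide_less_eq)
    qed (use elim in simp)
    then show ?case using e by simp
  qed
qed

lemma log_remainder_tendsto_zero:
  assumes dense: "closure (range (id_blinfun - T)) = UNIV"
  shows "(\<lambda>N. log_remainder N x) \<longlonglongrightarrow> 0"
proof (rule tendsto_zero_on_closure)
  show "\<forall>\<^sub>F N in sequentially. norm (log_remainder N) \<le> 4 * B"
    using eventually_gt_at_top[of 0] by eventually_elim (rule norm_log_remainder_le)
  show "(\<lambda>N. log_remainder N d) \<longlonglongrightarrow> 0" if "d \<in> range (id_blinfun - T)" for d
  proof -
    from that obtain u where u: "d = (id_blinfun - T) u" by blast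
    show ?thesis
      using blinfun.tendsto[OF log_remainder_compose_tendsto_zero tendsto_const[of u]] by (simp add: u)
  qed
  show "x \<in> closure (range (id_blinfun - T))" using dense by simp
qed

text \<open>The Cesaro means fix every fixed point of \<open>T\<close>. On the range of
  \<open>I - T\<close> they telescope to \<open>(u - T^(n + 1) u) / (n + 1)\<close> and tend to 0;
  boundedness and density extend this to the whole space, so a fixed point is 0.\<close>

lemma inj_id_minus:
  assumes dense: "closure (range (id_blinfun - T)) = UNIV"
  shows "inj (id_blinfun - T)"
proof -
  have "x = 0" if "(id_blinfun - T) x = 0" for x
  proof -
    have fixed: "blinfun_pow T n x = x" for n
      using that by (induction n) (simp_all add: blinfun.diff_left)
    define A where "A n = (1 / (real n + 1)) *\<^sub>R (\<Sum>j\<le>n. blinfun_pow T j)" for n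
    have "(\<lambda>n. A n x) \<longlonglongrightarrow> 0"
    proof (rule tendsto_zero_on_closure)
      show "\<forall>\<^sub>F n in sequentially. norm (A n) \<le> B"
        using norm_sum_pow_le by (simp add: A_def pos_divide_le_eq)
      show "(\<lambda>n. A n d) \<longlonglongrightarrow> 0" if "d \<in> range (id_blinfun - T)" for d
      proof -
        from that obtain u where u: "d = (id_blinfun - T) u" by blast
        have tel: "(\<Sum>j\<le>n. blinfun_pow T j (u - T u)) = u - blinfun_pow T (Suc n) u" for n
        proof (induction n)
          case (Suc n)
          then show ?case
            using blinfun_pow_apply_commute[of T "Suc n" 1 u] by (simp add: blinfun.diff_right)
        qed simp
        have A: "A n d = (1 / (real n + 1)) *\<^sub>R u - (1 / (real n + 1)) *\<^sub>R T (blinfun_pow T n u)" for n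
          by (simp add: A_def u blinfun.diff_left blinfun.scaleR_left blinfun.sum_left tel
              scaleR_diff_right)
        have "(\<lambda>n. (1 / (real n + 1)) *\<^sub>R blinfun_pow T n) \<longlonglongrightarrow> 0"
          by (rule tendsto_norm_zero_cancel) (use pow_div_tendsto_zero in simp)
        from blinfun.tendsto[OF tendsto_const[of T] blinfun.tendsto[OF this tendsto_const[of u]]]
        have "(\<lambda>n. (1 / (real n + 1)) *\<^sub>R T (blinfun_pow T n u)) \<longlonglongrightarrow> 0"
          by (simp add: blinfun.scaleR_left blinfun.scaleR_right)
        moreover have "(\<lambda>n. (1 / (real n + 1)) *\<^sub>R u) \<longlonglongrightarrow> 0 *\<^sub>R u"
          using LIMSEQ_inverse_real_of_nat
          by (intro tendsto_intros) (simp add: inverse_eq_divide add.commute)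
        ultimately show ?thesis
          unfolding A by (simp add: tendsto_diff[of _ 0 _ _ 0, simplified])
      qed
      show "x \<in> closure (range (id_blinfun - T))" using dense by simp
    qed
    moreover have "A n x = x" for n
      by (simp add: A_def blinfun.scaleR_left blinfun.sum_left fixed add.commute
          sum_constant_scaleR)
    ultimately show ?thesis
      by (simp add: LIMSEQ_const_iff)
  qed
  then show ?thesis
    by (intro injI) (metis blinfun.diff_right right_minus_eq)
qed

text \<open>Summation by parts with \<open>1 / (N + 1) - 1 / (N + 2) = log_coeff (N + 2)\<close>
  gives the partial sums of \<open>- L x\<close> up to the boundary term
  \<open>T^(N + 2) x / (N + 1)\<close>, which tends to 0.\<close>

lemma id_minus_log_partial_tendsto:
  assumes L: "(\<lambda>n. log_coeff n *\<^sub>R blinfun_pow T n) sums L"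
  shows "(\<lambda>N. (id_blinfun - T) (T (log_partial N x))) \<longlonglongrightarrow> - L x"
proof -
  have eq: "(id_blinfun - T) (T (log_partial (Suc N) x)) =
      - (\<Sum>n\<le>Suc N. log_coeff n *\<^sub>R blinfun_pow T n x) - (1 / (real N + 1)) *\<^sub>R T (T (blinfun_pow T N x))" for N
  proof (induction N)
    case 0
    show ?case by (simp add: log_partial_def log_coeff_def blinfun.diff_left)
  next
    case (Suc N)
    define u where "u = T (T (blinfun_pow T N x))"
    have "log_partial (Suc (Suc N)) x = log_partial (Suc N) x + (1 / (real N + 2)) *\<^sub>R T (blinfun_pow T N x)"
      by (simp add: log_partial_def blinfun.add_left blinfun.scaleR_left add.commute)
    then have "(id_blinfun - T) (T (log_partial (Suc (Suc N)) x)) =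
        (id_blinfun - T) (T (log_partial (Suc N) x)) + (1 / (real N + 2)) *\<^sub>R (u - T u)"
      by (simp add: blinfun.add_right blinfun.diff_left blinfun.scaleR_right u_def algebra_simps)
    also have "\<dots> = - (\<Sum>n\<le>Suc N. log_coeff n *\<^sub>R blinfun_pow T n x) - (1 / (real N + 1)) *\<^sub>R u
        + (1 / (real N + 2)) *\<^sub>R (u - T u)"
      by (simp only: Suc u_def)
    also have "\<dots> = - (\<Sum>n\<le>Suc N. log_coeff n *\<^sub>R blinfun_pow T n x)
        - (1 / (real N + 1) - 1 / (real N + 2)) *\<^sub>R u - (1 / (real N + 2)) *\<^sub>R T u"
      by (simp add: algebra_simps)
    also have "1 / (real N + 1) - 1 / (real N + 2) = log_coeff (Suc (Suc N))"
      by (simp add: log_coeff_def field_simps)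
    finally show ?case by (simp add: u_def add.commute)
  qed
  have "(\<lambda>n. log_coeff n *\<^sub>R blinfun_pow T n x) sums L x"
    using bounded_linear.sums[OF blinfun.bounded_linear_left L] by (simp add: blinfun.scaleR_left)
  then have "(\<lambda>N. \<Sum>n\<le>Suc N. log_coeff n *\<^sub>R blinfun_pow T n x) \<longlonglongrightarrow> L x"
    unfolding sums_def_le by (rule LIMSEQ_Suc)
  moreover have "(\<lambda>N. (1 / (real N + 1)) *\<^sub>R T (T (blinfun_pow T N x))) \<longlonglongrightarrow> 0"
  proof -
    have "(\<lambda>n. (1 / (real n + 1)) *\<^sub>R blinfun_pow T n) \<longlonglongrightarrow> 0"
      by (rule tendsto_norm_zero_cancel) (use pow_div_tendsto_zero in simp)
    from blinfun.tendsto[OF tendsto_const[of "T o\<^sub>L T"] blinfun.tendsto[OF this tendsto_const[of x]]]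
    show ?thesis by (simp add: blinfun.scaleR_left blinfun.scaleR_right)
  qed
  ultimately have "(\<lambda>N. (id_blinfun - T) (T (log_partial (Suc N) x))) \<longlonglongrightarrow> - L x - 0"
    unfolding eq by (intro tendsto_intros)
  then show ?thesis by (simp add: LIMSEQ_imp_Suc)
qed

theorem log_partial_tendsto:
  assumes L: "(\<lambda>n. log_coeff n *\<^sub>R blinfun_pow T n) sums L"
    and dense: "closure (range (id_blinfun - T)) = UNIV"
    and y: "L x = (id_blinfun - T) y"
  shows "(\<lambda>N. T (log_partial N x)) \<longlonglongrightarrow> - y"
proof -
  have lp: "log_partial N (gregory_op v) = v - log_remainder N v" for N v
    by (simp add: log_remainder_def blinfun.diff_left)
  have lim: "(\<lambda>N. log_partial N (gregory_op v)) \<longlonglongrightarrow> v" for v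
    using tendsto_diff[OF tendsto_const[of v] log_remainder_tendsto_zero[OF dense, of v]] by (simp add: lp)
  \<comment> \<open>Commuting \<open>G\<close> past \<open>A\<^sub>N\<close> computes this limit a
    second time, as \<open>(I - T) T x\<close>. The comparison yields
    \<open>- G L x = (I - T) T x\<close> without multiplying the series for \<open>G\<close> and
    \<open>L\<close>.\<close>
  have "(\<lambda>N. gregory_op ((id_blinfun - T) (T (log_partial N x)))) \<longlonglongrightarrow> gregory_op (- L x)"
    by (intro blinfun.tendsto tendsto_const id_minus_log_partial_tendsto L)
  moreover have "gregory_op ((id_blinfun - T) (T (log_partial N x))) =
      log_partial N (gregory_op ((id_blinfun - T) (T x)))" for N
    by (simp add: blinfun.diff_left blinfun.diff_right log_partial_commute
        log_partial_gregory_op_commute gregory_op_commute)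
  ultimately have "gregory_op (- L x) = (id_blinfun - T) (T x)"
    using LIMSEQ_unique[OF _ lim] by simp
  then have "(id_blinfun - T) (gregory_op y) = (id_blinfun - T) (- T x)"
    by (simp add: y blinfun.diff_left blinfun.diff_right blinfun.minus_right gregory_op_commute
        algebra_simps)
  then have "gregory_op y = - T x"
    by (rule injD[OF inj_id_minus[OF dense]])
  then have "T (log_partial N x) = - log_partial N (gregory_op y)" for N
    by (simp add: blinfun.minus_right log_partial_commute)
  then show ?thesis
    using tendsto_minus[OF lim[of y]] by simp
qed

end

subsection \<open>Consequences of \<open>(C, \<alpha>)\<close>-boundedness\<close>

lemma sum_triangle_swap:
  fixes f :: "nat \<Rightarrow> nat \<Rightarrow> 'a::comm_monoid_add"
  shows "(\<Sum>m\<le>K. \<Sum>n\<le>m. f m n) = (\<Sum>n\<le>K. \<Sum>i\<le>K - n. f (n + i) n)"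
proof -
  have "(\<Sum>m\<le>K. \<Sum>n\<le>m. f m n) = (\<Sum>(m, n)\<in>Sigma {..K} (\<lambda>m. {..m}). f m n)"
    by (rule sum.Sigma) auto
  also have "\<dots> = (\<Sum>(n, i)\<in>Sigma {..K} (\<lambda>n. {..K - n}). f (n + i) n)"
    by (rule sum.reindex_bij_witness[of _ "\<lambda>(n, i). (n + i, n)" "\<lambda>(m, n). (n, m - n)"]) auto
  also have "\<dots> = (\<Sum>n\<le>K. \<Sum>i\<le>K - n. f (n + i) n)"
    by (rule sum.Sigma[symmetric]) auto
  finally show ?thesis .
qed

text \<open>Kernel orders add under convolution: \<open>\<beta> = 1 - \<alpha>\<close> recovers the
  sums of powers and \<open>\<beta> = - \<alpha>\<close> the powers themselves.\<close>

lemma cesaro_sum_convolution: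
  "(\<Sum>j\<le>n. cesaro_kernel \<beta> (n - j) *\<^sub>R cesaro_sum \<alpha> T j) = cesaro_sum (\<alpha> + \<beta>) T n"
proof -
  have "(\<Sum>j\<le>n. cesaro_kernel \<beta> (n - j) *\<^sub>R cesaro_sum \<alpha> T j) =
      (\<Sum>j\<le>n. \<Sum>i\<le>j. (cesaro_kernel \<alpha> (j - i) * cesaro_kernel \<beta> (n - j)) *\<^sub>R blinfun_pow T i)"
    by (simp add: cesaro_sum_def scaleR_sum_right mult.commute)
  also have "\<dots> = (\<Sum>i\<le>n. \<Sum>l\<le>n - i.
      (cesaro_kernel \<alpha> l * cesaro_kernel \<beta> (n - i - l)) *\<^sub>R blinfun_pow T i)"
    by (subst sum_triangle_swap) simp
  also have "\<dots> = cesaro_sum (\<alpha> + \<beta>) T n"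
    unfolding cesaro_sum_def scaleR_sum_left[symmetric] cesaro_kernel_convolution ..
  finally show ?thesis .
qed

lemma cesaro_sum_0: "cesaro_sum 0 T n = blinfun_pow T n"
proof -
  have "cesaro_sum 0 T n = (\<Sum>j\<in>{..n}. if j = n then blinfun_pow T j else 0)"
    unfolding cesaro_sum_def by (intro sum.cong) (auto simp: cesaro_kernel_zero_left)
  then show ?thesis by simp
qed

lemma cesaro_sum_1: "cesaro_sum 1 T n = (\<Sum>j\<le>n. blinfun_pow T j)"
  by (simp add: cesaro_sum_def)

lemma cesaro_kernel_ge_1_mono:
  assumes "1 \<le> \<alpha>" "m \<le> n"
  shows "cesaro_kernel \<alpha> m \<le> cesaro_kernel \<alpha> n"
proof (rule lift_Suc_mono_le[OF _ assms(2)])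
  fix n
  have "1 \<le> (\<alpha> + real n) / (real n + 1)" using assms by simp
  then show "cesaro_kernel \<alpha> n \<le> cesaro_kernel \<alpha> (Suc n)"
    using cesaro_kernel_nonneg[of \<alpha> n] assms
      mult_left_mono[of 1 "(\<alpha> + real n) / (real n + 1)" "cesaro_kernel \<alpha> n"]
    by (simp add: cesaro_kernel_Suc)
qed

text \<open>Only the term at index 0 is positive, so the absolute values sum to
  \<open>2 - cesaro_kernel (1 - \<alpha>) m\<close>.\<close>

lemma sum_abs_cesaro_kernel_minus_le:
  assumes "0 \<le> \<alpha>" "\<alpha> \<le> 1"
  shows "(\<Sum>i\<le>m. \<bar>cesaro_kernel (- \<alpha>) i\<bar>) \<le> 2"
proof -
  have "\<bar>cesaro_kernel (- \<alpha>) i\<bar> = (if i = 0 then 2 else 0) - cesaro_kernel (- \<alpha>) i" for i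
    using cesaro_kernel_minus_nonpos[OF assms] by (cases i) (auto simp: abs_of_nonpos)
  then have "(\<Sum>i\<le>m. \<bar>cesaro_kernel (- \<alpha>) i\<bar>) = 2 - cesaro_kernel (1 - \<alpha>) m"
    by (simp add: sum_subtractf sum_cesaro_kernel)
  then show ?thesis using cesaro_kernel_nonneg[of "1 - \<alpha>" m] assms by simp
qed

text \<open>The growth factor \<open>1 + \<alpha> / j\<close> is at most
  \<open>exp (\<alpha> / j)\<close>, hence at most \<open>(j / (j - 1)) powr \<alpha>\<close>, and
  these factors telescope.\<close>

lemma cesaro_kernel_le_powr:
  assumes "0 \<le> \<alpha>"
  shows "cesaro_kernel (\<alpha> + 1) (Suc n) \<le> (\<alpha> + 1) * real (Suc n) powr \<alpha>"
proof (induction n)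
  case (Suc n)
  define j where "j = real (Suc (Suc n))"
  have j: "2 \<le> j" "real (Suc n) = j - 1" by (auto simp: j_def)
  have "ln ((j - 1) / j) \<le> (j - 1) / j - 1"
    by (rule ln_le_minus_one) (use j in simp)
  then have "1 / j \<le> ln (j / (j - 1))"
    using j by (simp add: ln_div field_simps)
  have "1 + \<alpha> / j \<le> exp (\<alpha> / j)" by simp
  also have "\<dots> \<le> exp (\<alpha> * ln (j / (j - 1)))"
    using mult_left_mono[OF \<open>1 / j \<le> ln (j / (j - 1))\<close> assms] by simp
  also have "\<dots> = (j / (j - 1)) powr \<alpha>"
    using j by (simp add: powr_def)
  finally have step: "1 + \<alpha> / j \<le> (j / (j - 1)) powr \<alpha>" .
  have "cesaro_kernel (\<alpha> + 1) (Suc (Suc n)) = cesaro_kernel (\<alpha> + 1) (Suc n) * (1 + \<alpha> / j)"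
    unfolding cesaro_kernel_Suc[of _ "Suc n"] by (simp add: j_def field_simps)
  also have "\<dots> \<le> (\<alpha> + 1) * (j - 1) powr \<alpha> * (j / (j - 1)) powr \<alpha>"
    using Suc j step assms by (intro mult_mono) auto
  also have "\<dots> = (\<alpha> + 1) * j powr \<alpha>"
    using j by (simp add: powr_divide)
  finally show ?case by (simp add: j_def)
qed (simp add: cesaro_kernel_Suc)

text \<open>The quotient is at most of order \<open>n powr (\<alpha> - 1)\<close>, and
  \<open>\<alpha> < 1\<close> makes this exponent negative.\<close>

lemma cesaro_kernel_div_tendsto_zero:
  assumes "0 \<le> \<alpha>" "\<alpha> < 1"
  shows "(\<lambda>n. cesaro_kernel (\<alpha> + 1) n / (real n + 1)) \<longlonglongrightarrow> 0"
proof (rule LIMSEQ_imp_Suc, rule tendsto_sandwich)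
  show "\<forall>\<^sub>F n in sequentially. 0 \<le> cesaro_kernel (\<alpha> + 1) (Suc n) / (real (Suc n) + 1)"
    using assms by (simp add: cesaro_kernel_nonneg)
  have "cesaro_kernel (\<alpha> + 1) (Suc n) / (real (Suc n) + 1) \<le> (\<alpha> + 1) * real (Suc n) powr (\<alpha> - 1)" for n
  proof -
    have "cesaro_kernel (\<alpha> + 1) (Suc n) / (real (Suc n) + 1) \<le>
        ((\<alpha> + 1) * real (Suc n) powr \<alpha>) / real (Suc n)"
      using assms by (intro frac_le cesaro_kernel_le_powr) auto
    then show ?thesis by (simp add: powr_diff)
  qed
  then show "\<forall>\<^sub>F n in sequentially. cesaro_kernel (\<alpha> + 1) (Suc n) / (real (Suc n) + 1) \<le>
      (\<alpha> + 1) * real (Suc n) powr (\<alpha> - 1)" by simp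
  have "(\<lambda>n. real (Suc n) powr (\<alpha> - 1)) \<longlonglongrightarrow> 0"
    by (rule tendsto_neg_powr[OF _ filterlim_compose[OF filterlim_real_sequentially filterlim_Suc]])
      (use assms in simp)
  from tendsto_mult_left[OF this, of "\<alpha> + 1"]
  show "(\<lambda>n. (\<alpha> + 1) * real (Suc n) powr (\<alpha> - 1)) \<longlonglongrightarrow> 0" by simp
qed auto

text \<open>The coefficients decay like \<open>n powr - 2\<close>, the kernel grows at most like
  \<open>n powr \<alpha>\<close>, and \<open>\<alpha> - 2 < - 1\<close>.\<close>

lemma summable_log_coeff_cesaro_kernel:
  assumes "0 \<le> \<alpha>" "\<alpha> < 1"
  shows "summable (\<lambda>n. \<bar>log_coeff n\<bar> * cesaro_kernel (\<alpha> + 1) n)"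
proof (rule summable_comparison_test)
  show "summable (\<lambda>n. 2 * (\<alpha> + 1) * real n powr (\<alpha> - 2))"
    using assms by (intro summable_mult) (simp add: summable_real_powr_iff)
  have "norm (\<bar>log_coeff n\<bar> * cesaro_kernel (\<alpha> + 1) n) \<le> 2 * (\<alpha> + 1) * real n powr (\<alpha> - 2)"
    if n: "2 \<le> n" for n
  proof -
    obtain m where m: "n = Suc m" "1 \<le> m" using n by (cases n) auto
    have "\<bar>log_coeff n\<bar> = 1 / (real m * real n)" using m by (simp add: log_coeff_def)
    \<comment> \<open>The factor 2 comes from \<open>n \<le> 2 * (n - 1)\<close> for
      \<open>n \<ge> 2\<close>.\<close>
    also have "\<dots> \<le> 2 / (real n * real n)"
    proof -
      have "real n * real n \<le> 2 * (real m * real n)"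
        using m mult_right_mono[of "real n" "2 * real m" "real n"] by simp
      then show ?thesis using m by (simp add: divide_simps del: of_nat_Suc)
    qed
    finally have h: "\<bar>log_coeff n\<bar> \<le> 2 / (real n * real n)" .
    have "\<bar>log_coeff n\<bar> * cesaro_kernel (\<alpha> + 1) n \<le> 2 / (real n * real n) * ((\<alpha> + 1) * real n powr \<alpha>)"
      using cesaro_kernel_le_powr[OF assms(1), of m] assms
      by (intro mult_mono h) (auto simp: m cesaro_kernel_nonneg)
    also have "\<dots> = 2 * (\<alpha> + 1) * real n powr (\<alpha> - 2)"
      using n by (simp add: powr_diff power2_eq_square)
    finally show ?thesis
      using assms by (simp add: cesaro_kernel_nonneg)
  qed
  then show "\<exists>N. \<forall>n\<ge>N. norm (\<bar>log_coeff n\<bar> * cesaro_kernel (\<alpha> + 1) n) \<le> 2 * (\<alpha> + 1) * real n powr (\<alpha> - 2)"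
    by blast
qed

section \<open>From \<open>(C, \<alpha>)\<close>-boundedness to means, powers and the functional
  calculus\<close>

locale cesaro_alpha_bounded =
  fixes \<alpha> :: real and T :: "'a::complex_banach \<Rightarrow>\<^sub>L 'a" and M :: real
  assumes \<alpha>: "0 < \<alpha>" "\<alpha> < 1"
    and norm_cesaro_sum_le: "\<And>n. norm (cesaro_sum \<alpha> T n) \<le> M * cesaro_kernel (\<alpha> + 1) n"
begin

lemma M_nonneg: "0 \<le> M"
  using order_trans[OF norm_ge_zero norm_cesaro_sum_le[of 0]] by simp

text \<open>The kernel of order \<open>1 - \<alpha>\<close> is nonnegative, so the bounds convolve:
  orders \<open>\<alpha> + 1\<close> and \<open>1 - \<alpha>\<close> add up to 2, and
  \<open>cesaro_kernel 2 n = n + 1\<close>.\<close>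

lemma norm_pow_sum_le: "norm (\<Sum>j\<le>n. blinfun_pow T j) \<le> M * (real n + 1)"
proof -
  have "(\<Sum>j\<le>n. blinfun_pow T j) = (\<Sum>j\<le>n. cesaro_kernel (1 - \<alpha>) (n - j) *\<^sub>R cesaro_sum \<alpha> T j)"
    by (simp add: cesaro_sum_convolution cesaro_sum_1)
  also have "norm \<dots> \<le> (\<Sum>j\<le>n. cesaro_kernel (1 - \<alpha>) (n - j) * (M * cesaro_kernel (\<alpha> + 1) j))"
    using \<alpha> by (intro order_trans[OF norm_sum] sum_mono)
      (simp add: cesaro_kernel_nonneg norm_cesaro_sum_le mult_left_mono)
  also have "\<dots> = M * (\<Sum>j\<le>n. cesaro_kernel (\<alpha> + 1) j * cesaro_kernel (1 - \<alpha>) (n - j))"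
    by (simp add: sum_distrib_left mult_ac)
  also have "\<dots> = M * (real n + 1)"
    by (simp add: cesaro_kernel_convolution cesaro_kernel_two_left)
  finally show ?thesis .
qed

text \<open>The bound at \<open>j\<close> is raised to the one at \<open>m\<close>, and the absolute
  kernel sum is at most 2. The case \<open>n = m\<close> bounds the powers; \<open>n < m\<close>
  serves the tails in the functional calculus.\<close>

lemma sum_kernel_norm_cesaro_sum_le:
  assumes "n \<le> m"
  shows "(\<Sum>j\<le>n. \<bar>cesaro_kernel (- \<alpha>) (m - j)\<bar> * norm (cesaro_sum \<alpha> T j)) \<le>
    2 * M * cesaro_kernel (\<alpha> + 1) m"
proof -
  have "(\<Sum>j\<le>n. \<bar>cesaro_kernel (- \<alpha>) (m - j)\<bar> * norm (cesaro_sum \<alpha> T j)) \<le>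
      (\<Sum>j\<le>m. \<bar>cesaro_kernel (- \<alpha>) (m - j)\<bar> * norm (cesaro_sum \<alpha> T j))"
    using assms by (intro sum_mono2) auto
  also have "\<dots> \<le> (\<Sum>j\<le>m. \<bar>cesaro_kernel (- \<alpha>) (m - j)\<bar> * (M * cesaro_kernel (\<alpha> + 1) m))"
  proof (intro sum_mono mult_left_mono)
    fix j assume "j \<in> {..m}"
    then have "M * cesaro_kernel (\<alpha> + 1) j \<le> M * cesaro_kernel (\<alpha> + 1) m"
      using \<alpha> M_nonneg by (intro mult_left_mono cesaro_kernel_ge_1_mono) auto
    then show "norm (cesaro_sum \<alpha> T j) \<le> M * cesaro_kernel (\<alpha> + 1) m"
      using norm_cesaro_sum_le[of j] by simp
  qed auto
  also have "\<dots> = (\<Sum>i\<le>m. \<bar>cesaro_kernel (- \<alpha>) i\<bar>) * (M * cesaro_kernel (\<alpha> + 1) m)"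
    using sum.nat_diff_reindex[of "\<lambda>i. \<bar>cesaro_kernel (- \<alpha>) i\<bar>" "Suc m"]
    by (simp add: lessThan_Suc_atMost flip: sum_distrib_right)
  also have "\<dots> \<le> 2 * (M * cesaro_kernel (\<alpha> + 1) m)"
    using \<alpha> M_nonneg
    by (intro mult_right_mono sum_abs_cesaro_kernel_minus_le mult_nonneg_nonneg cesaro_kernel_nonneg) auto
  finally show ?thesis by simp
qed

lemma pow_eq_sum_cesaro_sum:
  "blinfun_pow T n = (\<Sum>j\<le>n. cesaro_kernel (- \<alpha>) (n - j) *\<^sub>R cesaro_sum \<alpha> T j)"
  by (simp add: cesaro_sum_convolution cesaro_sum_0)

lemma norm_pow_le: "norm (blinfun_pow T n) \<le> 2 * M * cesaro_kernel (\<alpha> + 1) n"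
  unfolding pow_eq_sum_cesaro_sum
  by (rule order_trans[OF norm_sum]) (use sum_kernel_norm_cesaro_sum_le[of n n] in simp)

sublocale cesaro_mean_bounded T M
proof
  show "norm (\<Sum>j\<le>n. blinfun_pow T j) \<le> M * (real n + 1)" for n
    by (rule norm_pow_sum_le)
  show "(\<lambda>n. norm (blinfun_pow T n) / (real n + 1)) \<longlonglongrightarrow> 0"
  proof (rule tendsto_sandwich)
    show "\<forall>\<^sub>F n in sequentially. 0 \<le> norm (blinfun_pow T n) / (real n + 1)" by simp
    have "norm (blinfun_pow T n) / (real n + 1) \<le> 2 * M * (cesaro_kernel (\<alpha> + 1) n / (real n + 1))" for n
      using divide_right_mono[OF norm_pow_le[of n], of "real n + 1"] by simp
    then show "\<forall>\<^sub>F n in sequentially. norm (blinfun_pow T n) / (real n + 1) \<le>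
        2 * M * (cesaro_kernel (\<alpha> + 1) n / (real n + 1))" by simp
    show "(\<lambda>n. 2 * M * (cesaro_kernel (\<alpha> + 1) n / (real n + 1))) \<longlonglongrightarrow> 0"
      using tendsto_mult_left[OF cesaro_kernel_div_tendsto_zero, of \<alpha> "2 * M"] \<alpha> by simp
  qed auto
qed

text \<open>The partial sums of the two series differ by a double sum over \<open>n \<le> K < m\<close>, which is dominated
  by the tail of \<open>\<Sum>m. \<bar>h m\<bar> * cesaro_kernel (\<alpha> + 1) m\<close>.\<close>

lemma weyl_diff_cesaro_sums:
  fixes h :: "nat \<Rightarrow> real"
  assumes h: "summable (\<lambda>n. \<bar>h n\<bar> * cesaro_kernel (\<alpha> + 1) n)"
  obtains L where "(\<lambda>n. h n *\<^sub>R blinfun_pow T n) sums L"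
    and "(\<lambda>n. weyl_diff \<alpha> (\<lambda>m. of_real (h m)) n *\<^sub>C cesaro_sum \<alpha> T n) sums L"
proof -
  define k where "k = cesaro_kernel (- \<alpha>)"
  define S where "S = cesaro_sum \<alpha> T"
  define L where "L = (\<Sum>n. h n *\<^sub>R blinfun_pow T n)"
  have "summable (\<lambda>n. h n *\<^sub>R blinfun_pow T n)"
  proof (rule summable_comparison_test)
    show "summable (\<lambda>n. 2 * M * (\<bar>h n\<bar> * cesaro_kernel (\<alpha> + 1) n))"
      by (rule summable_mult[OF h])
    have "norm (h n *\<^sub>R blinfun_pow T n) \<le> 2 * M * (\<bar>h n\<bar> * cesaro_kernel (\<alpha> + 1) n)" for n
      using mult_left_mono[OF norm_pow_le[of n], of "\<bar>h n\<bar>"] by (simp add: mult_ac)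
    then show "\<exists>N. \<forall>n\<ge>N. norm (h n *\<^sub>R blinfun_pow T n) \<le> 2 * M * (\<bar>h n\<bar> * cesaro_kernel (\<alpha> + 1) n)"
      by blast
  qed
  then have L: "(\<lambda>n. h n *\<^sub>R blinfun_pow T n) sums L"
    unfolding L_def by (rule summable_sums)
  have k_le: "\<bar>k i\<bar> \<le> 2" for i
  proof -
    have "\<bar>k i\<bar> \<le> (\<Sum>j\<le>i. \<bar>k j\<bar>)"
      by (rule member_le_sum) auto
    also have "\<dots> \<le> 2"
      unfolding k_def by (rule sum_abs_cesaro_kernel_minus_le) (use \<alpha> in auto)
    finally show ?thesis .
  qed
  have h_le: "\<bar>h n\<bar> \<le> \<bar>h n\<bar> * cesaro_kernel (\<alpha> + 1) n" for n
    using mult_left_mono[OF cesaro_kernel_ge_1_mono[of "\<alpha> + 1" 0 n], of "\<bar>h n\<bar>"] \<alpha> by simp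
  have abs_h: "summable (\<lambda>n. \<bar>h n\<bar>)"
    by (rule summable_comparison_test[OF _ h]) (use h_le in auto)
  \<comment> \<open>The index map \<open>a\<close> is arbitrary because only the uniform bound on
    \<open>k\<close> enters; the tails use a shift depending on \<open>K\<close> and
    \<open>n\<close>.\<close>
  have abs_kh: "summable (\<lambda>i. \<bar>k (a i) * h (i + b)\<bar>)" for a b
  proof (rule summable_comparison_test)
    show "summable (\<lambda>i. 2 * \<bar>h (i + b)\<bar>)"
      by (intro summable_mult summable_ignore_initial_segment abs_h)
    show "\<exists>N. \<forall>i\<ge>N. norm \<bar>k (a i) * h (i + b)\<bar> \<le> 2 * \<bar>h (i + b)\<bar>"
      using k_le by (auto simp: abs_mult intro!: mult_right_mono)
  qed
  have kh: "summable (\<lambda>i. k (a i) * h (i + b))" for a b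
    by (rule summable_rabs_cancel[OF abs_kh])
  define w where "w n = (\<Sum>i. k i * h (n + i))" for n
  have w: "weyl_diff \<alpha> (\<lambda>m. of_real (h m)) n = of_real (w n)" for n
    using suminf_of_real[OF kh[of "\<lambda>i. i" n], where 'a = complex]
    by (simp add: weyl_diff_def w_def k_def add.commute)
  \<comment> \<open>The part of \<open>w n\<close> from the indices \<open>m = i + Suc K\<close>
    beyond \<open>K\<close>; the kernel argument is \<open>m - n\<close>.\<close>
  define tail where "tail K n = (\<Sum>i. k (i + Suc K - n) * h (i + Suc K))" for K n
  have w_split: "w n = (\<Sum>i\<le>K - n. k i * h (n + i)) + tail K n" if "n \<le> K" for n K
  proof -
    have "summable (\<lambda>i. k i * h (n + i))"
      using kh[of "\<lambda>i. i" n] by (simp add: add.commute)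
    from suminf_split_initial_segment[OF this, of "Suc (K - n)"]
    have "w n = (\<Sum>i. k (i + Suc (K - n)) * h (n + (i + Suc (K - n)))) + (\<Sum>i\<le>K - n. k i * h (n + i))"
      by (simp only: w_def lessThan_Suc_atMost)
    moreover have "i + Suc (K - n) = i + Suc K - n" "n + (i + Suc K - n) = i + Suc K" for i
      using that by auto
    ultimately show ?thesis by (simp only: tail_def add.commute)
  qed
  have diff: "(\<Sum>n\<le>K. w n *\<^sub>R S n) - (\<Sum>m\<le>K. h m *\<^sub>R blinfun_pow T m) = (\<Sum>n\<le>K. tail K n *\<^sub>R S n)" for K
  proof -
    \<comment> \<open>Expanding each power in the Cesaro sums turns both partial sums into
      combinations of \<open>S n\<close>; they share the triangle
      \<open>n \<le> m \<le> K\<close>.\<close>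
    have "(\<Sum>m\<le>K. h m *\<^sub>R blinfun_pow T m) = (\<Sum>m\<le>K. \<Sum>n\<le>m. (k (m - n) * h m) *\<^sub>R S n)"
      by (simp add: pow_eq_sum_cesaro_sum scaleR_sum_right k_def S_def mult.commute)
    also have "\<dots> = (\<Sum>n\<le>K. (\<Sum>i\<le>K - n. k i * h (n + i)) *\<^sub>R S n)"
      by (subst sum_triangle_swap) (simp add: scaleR_sum_left)
    finally show ?thesis
      by (simp add: w_split scaleR_add_left sum.distrib)
  qed
  have tail_le: "norm (\<Sum>n\<le>K. tail K n *\<^sub>R S n) \<le>
      (\<Sum>i. 2 * M * (\<bar>h (i + Suc K)\<bar> * cesaro_kernel (\<alpha> + 1) (i + Suc K)))" for K
  proof -
    have "norm (\<Sum>n\<le>K. tail K n *\<^sub>R S n) \<le> (\<Sum>n\<le>K. \<bar>tail K n\<bar> * norm (S n))"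
      by (rule order_trans[OF norm_sum]) simp
    also have "\<dots> \<le> (\<Sum>n\<le>K. (\<Sum>i. \<bar>k (i + Suc K - n) * h (i + Suc K)\<bar>) * norm (S n))"
      unfolding tail_def by (intro sum_mono mult_right_mono summable_rabs abs_kh) auto
    also have "\<dots> = (\<Sum>n\<le>K. (\<Sum>i. \<bar>k (i + Suc K - n) * h (i + Suc K)\<bar> * norm (S n)))"
      by (intro sum.cong refl suminf_mult2 abs_kh)
    also have "\<dots> = (\<Sum>i. \<Sum>n\<le>K. \<bar>k (i + Suc K - n) * h (i + Suc K)\<bar> * norm (S n))"
      by (intro suminf_sum[symmetric] summable_mult2 abs_kh)
    also have "\<dots> \<le> (\<Sum>i. 2 * M * (\<bar>h (i + Suc K)\<bar> * cesaro_kernel (\<alpha> + 1) (i + Suc K)))"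
    proof (rule suminf_le)
      show "summable (\<lambda>i. \<Sum>n\<le>K. \<bar>k (i + Suc K - n) * h (i + Suc K)\<bar> * norm (S n))"
        by (intro summable_sum summable_mult2 abs_kh)
      show "summable (\<lambda>i. 2 * M * (\<bar>h (i + Suc K)\<bar> * cesaro_kernel (\<alpha> + 1) (i + Suc K)))"
        by (intro summable_mult summable_ignore_initial_segment[OF h])
      fix i
      have "(\<Sum>n\<le>K. \<bar>k (i + Suc K - n) * h (i + Suc K)\<bar> * norm (S n)) =
          \<bar>h (i + Suc K)\<bar> * (\<Sum>n\<le>K. \<bar>k (i + Suc K - n)\<bar> * norm (S n))"
        by (simp add: sum_distrib_left abs_mult mult_ac)
      also have "\<dots> \<le> \<bar>h (i + Suc K)\<bar> * (2 * M * cesaro_kernel (\<alpha> + 1) (i + Suc K))"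
        unfolding k_def S_def by (intro mult_left_mono sum_kernel_norm_cesaro_sum_le) auto
      finally show "(\<Sum>n\<le>K. \<bar>k (i + Suc K - n) * h (i + Suc K)\<bar> * norm (S n)) \<le>
          2 * M * (\<bar>h (i + Suc K)\<bar> * cesaro_kernel (\<alpha> + 1) (i + Suc K))"
        by (simp only: mult_ac)
    qed
    finally show ?thesis .
  qed
  have "(\<lambda>K. \<Sum>n\<le>K. tail K n *\<^sub>R S n) \<longlonglongrightarrow> 0"
  proof (rule Lim_null_comparison)
    show "\<forall>\<^sub>F K in sequentially. norm (\<Sum>n\<le>K. tail K n *\<^sub>R S n) \<le>
        (\<Sum>i. 2 * M * (\<bar>h (i + Suc K)\<bar> * cesaro_kernel (\<alpha> + 1) (i + Suc K)))"
      using tail_le by (intro always_eventually allI)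
    show "(\<lambda>K. \<Sum>i. 2 * M * (\<bar>h (i + Suc K)\<bar> * cesaro_kernel (\<alpha> + 1) (i + Suc K))) \<longlonglongrightarrow> 0"
      using LIMSEQ_Suc[OF suminf_exist_split2[OF summable_mult[OF h, of "2 * M"]]] by simp
  qed
  from tendsto_add[OF this L[unfolded sums_def_le]]
  have "(\<lambda>n. w n *\<^sub>R S n) sums L"
    unfolding sums_def_le by (simp flip: diff)
  then have "(\<lambda>n. weyl_diff \<alpha> (\<lambda>m. of_real (h m)) n *\<^sub>C cesaro_sum \<alpha> T n) sums L"
    by (simp add: w scaleC_of_real S_def)
  with L show ?thesis by (rule that)
qed

text \<open>The Taylor coefficients are summable against the kernel, so the functional calculus
  agrees with the plain Taylor series in \<open>T\<close>.\<close>

lemma fun_calc_log_sums: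
  "(\<lambda>n. log_coeff n *\<^sub>R blinfun_pow T n) sums fun_calc \<alpha> T (\<lambda>z. (1 - z) * Ln (1 - z))"
proof -
  obtain L where L: "(\<lambda>n. log_coeff n *\<^sub>R blinfun_pow T n) sums L"
    and "(\<lambda>n. weyl_diff \<alpha> (\<lambda>m. of_real (log_coeff m)) n *\<^sub>C cesaro_sum \<alpha> T n) sums L"
    by (rule weyl_diff_cesaro_sums[OF summable_log_coeff_cesaro_kernel]) (use \<alpha> in auto)
  moreover have "taylor_coeff (\<lambda>z. (1 - z) * Ln (1 - z)) = (\<lambda>m. of_real (log_coeff m))"
    by (auto simp: taylor_coeff_log(1) log_coeff_def)
  \<comment> \<open>Membership in the algebra selects the series branch of \<open>fun_calc\<close>
    rather than its default \<open>0\<close>.\<close>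
  ultimately have "fun_calc \<alpha> T (\<lambda>z. (1 - z) * Ln (1 - z)) = L"
    using log_mem_weighted_disc_algebra[OF \<alpha>(1)] by (simp add: fun_calc_def sums_iff)
  with L show ?thesis by (simp only:)
qed

end

section \<open>Weak convergence and the equivalence\<close>

lemma cesaro_alpha_boundedI:
  assumes "0 < \<alpha>" "\<alpha> < 1" "cesaro_bounded \<alpha> T"
  obtains M where "cesaro_alpha_bounded \<alpha> T M"
proof -
  obtain M where M: "norm (cesaro_sum \<alpha> T n) / cesaro_kernel (\<alpha> + 1) n \<le> M" for n
    using assms(3) by (auto simp: cesaro_bounded_def bdd_above_def)
  have "0 < cesaro_kernel (\<alpha> + 1) n" for n
    using cesaro_kernel_ge_1_mono[of "\<alpha> + 1" 0 n] assms by simp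
  then have "cesaro_alpha_bounded \<alpha> T M"
    using M assms by unfold_locales (auto simp: pos_divide_le_eq)
  then show ?thesis by (rule that)
qed

lemma bounded_clinear_apply_sums:
  assumes "bounded_clinear \<phi>" "f sums s"
  shows "(\<lambda>n. \<phi> (f n)) sums \<phi> s"
  using assms bounded_linear.sums by (auto simp: bounded_clinear_def)

text \<open>Allows weak convergence to be tested after applying \<open>I - T\<close>; complex
  linearity of \<open>T\<close> makes the composite an admissible functional.\<close>

lemma bounded_clinear_compose_id_minus:
  assumes "bounded_clinear \<phi>" "bounded_clinear (blinfun_apply T)"
  shows "bounded_clinear (\<lambda>v. \<phi> ((id_blinfun - T) v))"
  unfolding bounded_clinear_def
proof (intro conjI allI)
  show "bounded_linear (\<lambda>v. \<phi> ((id_blinfun - T) v))"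
    using assms(1) by (intro bounded_linear_compose[OF _ blinfun.bounded_linear_right])
      (simp add: bounded_clinear_def)
  have "(id_blinfun - T) (c *\<^sub>C v) = c *\<^sub>C (id_blinfun - T) v" for c v
    using assms(2) linear_diff[OF bounded_linear.linear[OF bounded_linear_scaleC[of c]], of v "T v"]
    by (simp add: blinfun.diff_left bounded_clinear_def)
  then show "\<phi> ((id_blinfun - T) (c *\<^sub>C v)) = c *\<^sub>C \<phi> ((id_blinfun - T) v)" for c v
    using assms(1) by (simp add: bounded_clinear_def)
qed

theorem theorem7:
  fixes \<alpha> :: real and T :: "'a::complex_banach \<Rightarrow>\<^sub>L 'a" and x :: 'a
  assumes "0 < \<alpha>" and "\<alpha> < 1"
    and "bounded_clinear T"
    and "cesaro_bounded \<alpha> T"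
    and "closure (range (id_blinfun - T)) = UNIV"
  defines "s \<equiv> \<lambda>n. (1 / real (Suc n)) *\<^sub>R blinfun_pow T (Suc n) x"
  shows "(x \<in> dom_log_one_minus \<alpha> T \<longleftrightarrow> summable s) \<and>
    (summable s \<longleftrightarrow> weakly_summable s) \<and>
    (x \<in> dom_log_one_minus \<alpha> T \<or> summable s \<longrightarrow> log_one_minus \<alpha> T x = - (\<Sum>n. s n))"
proof -
  note dense = assms(5)
  obtain M where "cesaro_alpha_bounded \<alpha> T M"
    using cesaro_alpha_boundedI assms by blast
  then interpret cesaro_alpha_bounded \<alpha> T M .
  define L where "L = fun_calc \<alpha> T (\<lambda>z. (1 - z) * Ln (1 - z))"
  note L = fun_calc_log_sums[folded L_def]
  \<comment> \<open>The terms of \<open>s\<close> begin with the first power of \<open>T\<close>,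
    hence the extra \<open>T\<close> in front of \<open>A\<^sub>N\<close>.\<close>
  have partial: "(\<Sum>n<N. s n) = T (log_partial N x)" for N
    by (simp add: s_def log_partial_def blinfun.sum_left blinfun.sum_right blinfun.scaleR_left
        blinfun.scaleR_right add.commute)
  have dom_iff: "x \<in> dom_log_one_minus \<alpha> T \<longleftrightarrow> (\<exists>y. L x = (id_blinfun - T) y)"
    by (auto simp: dom_log_one_minus_def L_def)
  have sums: "s sums - y" if "L x = (id_blinfun - T) y" for y
    unfolding sums_def partial by (rule log_partial_tendsto[OF L dense that])
  \<comment> \<open>Under a functional, \<open>I - T\<close> applied to the partial sums tends both
    to the value at \<open>(I - T) y\<close> and to the value at \<open>- L x\<close>; a functional
    separating these two vectors would contradict this.\<close>
  have weak: "L x = (id_blinfun - T) (- y)" if y: "weakly_sums s y" for y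
  proof (rule ccontr)
    define v where "v = L x + (id_blinfun - T) y"
    assume "L x \<noteq> (id_blinfun - T) (- y)"
    then have "v \<noteq> 0"
      by (simp add: v_def blinfun.minus_right eq_neg_iff_add_eq_0)
    then obtain \<phi> :: "'a \<Rightarrow> complex" where \<phi>: "bounded_clinear \<phi>" "\<phi> v \<noteq> 0"
      using bounded_clinear_functional_nonzero by blast
    interpret \<phi>: bounded_linear \<phi>
      using \<phi>(1) by (simp add: bounded_clinear_def)
    have "bounded_clinear (\<lambda>v. \<phi> ((id_blinfun - T) v))"
      by (rule bounded_clinear_compose_id_minus[OF \<phi>(1) assms(3)])
    then have "(\<lambda>n. \<phi> ((id_blinfun - T) (s n))) sums \<phi> ((id_blinfun - T) y)"
      using y[unfolded weakly_sums_def] by blast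
    then have "(\<lambda>N. \<phi> ((id_blinfun - T) (T (log_partial N x)))) \<longlonglongrightarrow> \<phi> ((id_blinfun - T) y)"
      by (simp add: sums_def flip: partial \<phi>.sum blinfun.sum_right)
    moreover have "(\<lambda>N. \<phi> ((id_blinfun - T) (T (log_partial N x)))) \<longlonglongrightarrow> \<phi> (- L x)"
      by (intro \<phi>.tendsto id_minus_log_partial_tendsto L)
    ultimately have "\<phi> ((id_blinfun - T) y) = \<phi> (- L x)"
      by (rule LIMSEQ_unique)
    then have "\<phi> v = 0"
      by (simp add: v_def \<phi>.add \<phi>.neg)
    with \<phi>(2) show False by contradiction
  qed
  \<comment> \<open>The equivalences close into a cycle: norm convergence, weak convergence,
    membership in the domain, norm convergence.\<close>
  have "weakly_summable s" if "summable s"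
    using bounded_clinear_apply_sums[OF _ summable_sums[OF that]]
    by (auto simp: weakly_summable_def weakly_sums_def)
  moreover have "x \<in> dom_log_one_minus \<alpha> T" if "weakly_summable s"
    using that weak by (auto simp: dom_iff weakly_summable_def)
  moreover have "summable s" if "x \<in> dom_log_one_minus \<alpha> T"
    using that sums by (auto simp: dom_iff summable_def)
  moreover have "log_one_minus \<alpha> T x = - (\<Sum>n. s n)" if "x \<in> dom_log_one_minus \<alpha> T"
  proof -
    from that obtain y where y: "L x = (id_blinfun - T) y"
      using dom_iff by blast
    have "log_one_minus \<alpha> T x = the_inv (id_blinfun - T) (L x)"
      by (simp add: log_one_minus_def L_def)
    also have "\<dots> = y"
      unfolding y by (rule the_inv_f_f[OF inj_id_minus[OF dense]])
    finally show ?thesis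
      using sums[OF y] by (simp add: sums_iff)
  qed
  ultimately show ?thesis by blast
qed

end
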